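(* Let $\mathbb{E}$ be a locally compact second countable Hausdorff space, $S$ an arbitrary set, and $h:\mathbb{E}\times S\to[0,\infty]$ a function such that $h(\cdot,y)$ is measurable for every $y\in S$. For a random measure $\Lambda$ on $\mathbb{E}$ put $V_\Lambda(y)=\int_{\mathbb{E}}h(x,y)\,\Lambda(dx)$, $y\in S$. Let $\Lambda_1,\Lambda_2$ be random measures on $\mathbb{E}$. 1. If $\Lambda_1\le_{idcx}\Lambda_2$, then $\{V_{\Lambda_1}(y)\}_{y\in S}\le_{idcx}\{V_{\Lambda_2}(y)\}_{y\in S}$. Likewise, if $\Lambda_1\le_{idcv}\Lambda_2$, then $\{V_{\Lambda_1}(y)\}_{y\in S}\le_{idcv}\{V_{\Lambda_2}(y)\}_{y\in S}$. 2. Suppose $E(V_{\Lambda_i}(y))<\infty$ for all $y\in S$ and $i=1,2$. If $\Lambda_1\le_{dcx}\Lambda_2$, then $\{V_{\Lambda_1}(y)\}_{y\in S}\le_{dcx}\{V_{\Lambda_2}(y)\}_{y\in S}$.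
   Context: $\mathbb{R}^n$ carries the componentwise partial order. A function $f:\mathbb{R}^n\to\mathbb{R}$ is directionally convex (dcx) if $f(x)+f(y)\le f(p)+f(q)$ whenever $p\le x,y\le q$ and $x+y=p+q$; directionally concave (dcv) if the reverse inequality holds; idcx (resp. idcv) means increasing (i.e. non-decreasing for the componentwise order) and dcx (resp. dcv). For a class $\mathfrak F$ of functions (dcx, idcx, idcv) and random vectors $X,Y$ of the same dimension, $X\le_{\mathfrak F}Y$ means $E f(X)\le E f(Y)$ for all $f\in\mathfrak F$ for which both expectations are finite. For random fields indexed by a set, $\{X(s)\}\le_{\mathfrak F}\{Y(s)\}$ means $(X(s_1),\dots,X(s_n))\le_{\mathfrak F}(Y(s_1),\dots,Y(s_n))$ for all $n\ge1$ and all indices $s_1,\dots,s_n$. An increasing function is extended to vectors with coordinates in $[0,\infty]$ by monotone limits. A random measure on $\mathbb{E}$ is a random element of the space of non-negative Radon measures on $\mathbb{E}$ (with the $\sigma$-algebra generated by $\mu\mapsto\mu(B)$, $B$ bounded Borel; bounded means relatively compact). $\Lambda_1\le_{\mathfrak F}\Lambda_2$ for random measures means $(\Lambda_1(I_1),\dots,\Lambda_1(I_n))\le_{\mathfrak F}(\Lambda_2(I_1),\dots,\Lambda_2(I_n))$ for all $n\geq 1$ and all bounded Borel $I_1,\dots,I_n\subset\mathbb{E}$.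
   Formalization: The test functions f in the orders are taken to be Borel measurable; this is automatic for idcx and idcv, but for dcx part 2 fails if non-measurable (e.g. discontinuous additive) functions are admitted. *)

theory Defs
  imports "HOL-Probability.Probability"
begin

section \<open>Directionally convex functions\<close>

text \<open>
  \<open>\<real>\<^sup>n\<close> is rendered as the product measurable space of \<open>n\<close> copies of the Borel space of the reals:
  its points are the functions on \<open>{..<n}\<close>, extended by \<open>undefined\<close>, and its \<open>\<sigma>\<close>-algebra is the
  Borel one.  The dimension has to be a term because the orders on fields quantify over it.
\<close>

definition Rn :: "nat \<Rightarrow> (nat \<Rightarrow> real) measure" where
  "Rn n = (\<Pi>\<^sub>M i\<in>{..<n}. borel)"

definition vle :: "nat \<Rightarrow> (nat \<Rightarrow> real) \<Rightarrow> (nat \<Rightarrow> real) \<Rightarrow> bool" where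
  "vle n x y \<longleftrightarrow> (\<forall>i<n. x i \<le> y i)"

definition dcx :: "nat \<Rightarrow> ((nat \<Rightarrow> real) \<Rightarrow> real) \<Rightarrow> bool" where
  "dcx n f \<longleftrightarrow>
     (\<forall>x\<in>space (Rn n). \<forall>y\<in>space (Rn n). \<forall>p\<in>space (Rn n). \<forall>q\<in>space (Rn n).
        vle n p x \<and> vle n p y \<and> vle n x q \<and> vle n y q \<and> (\<forall>i<n. x i + y i = p i + q i)
        \<longrightarrow> f x + f y \<le> f p + f q)"

definition dcv :: "nat \<Rightarrow> ((nat \<Rightarrow> real) \<Rightarrow> real) \<Rightarrow> bool" where
  "dcv n f \<longleftrightarrow>
     (\<forall>x\<in>space (Rn n). \<forall>y\<in>space (Rn n). \<forall>p\<in>space (Rn n). \<forall>q\<in>space (Rn n).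
        vle n p x \<and> vle n p y \<and> vle n x q \<and> vle n y q \<and> (\<forall>i<n. x i + y i = p i + q i)
        \<longrightarrow> f p + f q \<le> f x + f y)"

definition increasing_fun :: "nat \<Rightarrow> ((nat \<Rightarrow> real) \<Rightarrow> real) \<Rightarrow> bool" where
  "increasing_fun n f \<longleftrightarrow> (\<forall>x\<in>space (Rn n). \<forall>y\<in>space (Rn n). vle n x y \<longrightarrow> f x \<le> f y)"

definition idcx :: "nat \<Rightarrow> ((nat \<Rightarrow> real) \<Rightarrow> real) \<Rightarrow> bool" where
  "idcx n f \<longleftrightarrow> increasing_fun n f \<and> dcx n f"

definition idcv :: "nat \<Rightarrow> ((nat \<Rightarrow> real) \<Rightarrow> real) \<Rightarrow> bool" where
  "idcv n f \<longleftrightarrow> increasing_fun n f \<and> dcv n f"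


section \<open>Integral orders on random fields\<close>

text \<open>
  \<open>\<FF>\<close> is a class of functions, given for each dimension.  The two fields may live on different
  probability spaces \<open>M\<close> and \<open>N\<close>, and the indices \<open>s 0, \<dots>, s (n - 1)\<close> need not be distinct.
  Test functions are Borel measurable.  This matters only for \<open>dcx\<close>, which, having no continuity
  requirement, also holds of the non-measurable additive functions.
\<close>

definition field_le ::
  "(nat \<Rightarrow> ((nat \<Rightarrow> real) \<Rightarrow> real) \<Rightarrow> bool) \<Rightarrow> 's set
    \<Rightarrow> 'w measure \<Rightarrow> ('w \<Rightarrow> 's \<Rightarrow> real) \<Rightarrow> 'v measure \<Rightarrow> ('v \<Rightarrow> 's \<Rightarrow> real) \<Rightarrow> bool" where
  "field_le \<FF> S M X N Y \<longleftrightarrow>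
     (\<forall>n\<ge>1. \<forall>s. (\<forall>i<n. s i \<in> S) \<longrightarrow>
       (\<forall>f. \<FF> n f \<and> f \<in> borel_measurable (Rn n) \<and>
            integrable M (\<lambda>\<omega>. f (\<lambda>i\<in>{..<n}. X \<omega> (s i))) \<and>
            integrable N (\<lambda>\<omega>. f (\<lambda>i\<in>{..<n}. Y \<omega> (s i)))
          \<longrightarrow> (\<integral>\<omega>. f (\<lambda>i\<in>{..<n}. X \<omega> (s i)) \<partial>M)
                \<le> (\<integral>\<omega>. f (\<lambda>i\<in>{..<n}. Y \<omega> (s i)) \<partial>N)))"

text \<open>
  The extension of an increasing \<open>f\<close> to \<open>[0,\<infinity>]\<^sup>n\<close> by monotone limits, along the truncations
  \<open>x \<and> m\<close>, \<open>m \<rightarrow> \<infinity>\<close>; the limit of an increasing sequence is its supremum, and it may be \<open>\<infinity>\<close>.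
\<close>

definition ext_mono :: "nat \<Rightarrow> ((nat \<Rightarrow> real) \<Rightarrow> real) \<Rightarrow> (nat \<Rightarrow> ennreal) \<Rightarrow> ereal" where
  "ext_mono n f x = (SUP m::nat. ereal (f (\<lambda>i\<in>{..<n}. enn2real (min (x i) (of_nat m)))))"

lemma ext_mono_finite:
  assumes f: "increasing_fun n f" and x: "x \<in> space (Rn n)" "\<And>i. i < n \<Longrightarrow> 0 \<le> x i"
  shows "ext_mono n f (\<lambda>i. ennreal (x i)) = ereal (f x)"
proof -
  define t where "t m = (\<lambda>i\<in>{..<n}. enn2real (min (ennreal (x i)) (of_nat m)))" for m :: nat
  have t_val: "t m i = min (x i) (real m)" if "i < n" for m i
    using that x(2)[OF that]
    by (simp add: t_def ennreal_of_nat_eq_real_of_nat min_def ennreal_le_iff)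
  have t_space: "t m \<in> space (Rn n)" for m
    by (simp add: t_def Rn_def space_PiM)
  have le: "f (t m) \<le> f x" for m
    using f t_space x(1) by (auto simp: increasing_fun_def vle_def t_val)
  obtain m where m: "\<And>i. i < n \<Longrightarrow> x i \<le> real m"
  proof -
    obtain m :: nat where "Max (insert 0 (x ` {..<n})) \<le> real m"
      using real_arch_simple by blast
    then show ?thesis by (intro that[of m]) auto
  qed
  have "t m = x"
  proof
    fix i show "t m i = x i"
    proof (cases "i < n")
      case True
      then show ?thesis using m[OF True] by (simp add: t_val)
    next
      case False
      then show ?thesis using x(1) by (simp add: t_def Rn_def space_PiM PiE_def extensional_def)
    qed
  qed
  then have "(SUP m. ereal (f (t m))) = ereal (f x)"
    using le by (intro antisym SUP_least SUP_upper2[of m]) auto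
  then show ?thesis by (simp add: ext_mono_def t_def)
qed

definition finite_expectation :: "'w measure \<Rightarrow> ('w \<Rightarrow> ereal) \<Rightarrow> bool" where
  "finite_expectation M Z \<longleftrightarrow> Z \<in> borel_measurable M \<and> (AE \<omega> in M. \<bar>Z \<omega>\<bar> \<noteq> \<infinity>) \<and>
     integrable M (\<lambda>\<omega>. real_of_ereal (Z \<omega>))"

text \<open>
  The same order for \<open>[0,\<infinity>]\<close>-valued fields; meaningful for classes of increasing functions only.
  For \<open>dcx\<close>, fields that are almost surely finite at each index are compared by \<open>field_le\<close>
  after applying \<open>enn2real\<close>, which changes them on null sets only.
\<close>

definition ext_field_le ::
  "(nat \<Rightarrow> ((nat \<Rightarrow> real) \<Rightarrow> real) \<Rightarrow> bool) \<Rightarrow> 's set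
    \<Rightarrow> 'w measure \<Rightarrow> ('w \<Rightarrow> 's \<Rightarrow> ennreal) \<Rightarrow> 'v measure \<Rightarrow> ('v \<Rightarrow> 's \<Rightarrow> ennreal) \<Rightarrow> bool" where
  "ext_field_le \<FF> S M X N Y \<longleftrightarrow>
     (\<forall>n\<ge>1. \<forall>s. (\<forall>i<n. s i \<in> S) \<longrightarrow>
       (\<forall>f. \<FF> n f \<and> f \<in> borel_measurable (Rn n) \<and>
            finite_expectation M (\<lambda>\<omega>. ext_mono n f (\<lambda>i. X \<omega> (s i))) \<and>
            finite_expectation N (\<lambda>\<omega>. ext_mono n f (\<lambda>i. Y \<omega> (s i)))
          \<longrightarrow> (\<integral>\<omega>. real_of_ereal (ext_mono n f (\<lambda>i. X \<omega> (s i))) \<partial>M)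
                \<le> (\<integral>\<omega>. real_of_ereal (ext_mono n f (\<lambda>i. Y \<omega> (s i))) \<partial>N)))"


section \<open>Random measures\<close>

definition bounded_borel :: "'e::topological_space set set" where
  "bounded_borel = {B \<in> sets borel. compact (closure B)}"

text \<open>
  On a locally compact second countable Hausdorff space the inner regularity is automatic,
  and finiteness on compact sets is local finiteness.
\<close>

definition radon_measures :: "'e::topological_space measure set" where
  "radon_measures = {\<mu>. sets \<mu> = sets borel \<and> (\<forall>K. compact K \<longrightarrow> emeasure \<mu> K < \<infinity>) \<and>
     (\<forall>B\<in>sets borel. emeasure \<mu> B = (SUP K\<in>{K. compact K \<and> K \<subseteq> B}. emeasure \<mu> K))}"

definition radon_space :: "'e::topological_space measure measure" where
  "radon_space =
     (SUP B\<in>bounded_borel. vimage_algebra radon_measures (\<lambda>\<mu>. emeasure \<mu> B) borel)"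

lemma space_radon_space: "space radon_space = radon_measures"
proof -
  have "{} \<in> bounded_borel" by (simp add: bounded_borel_def)
  then show ?thesis unfolding radon_space_def by (subst space_Sup_eq_UN) auto
qed

definition random_measure :: "'w measure \<Rightarrow> ('w \<Rightarrow> 'e::topological_space measure) \<Rightarrow> bool" where
  "random_measure M \<Lambda> \<longleftrightarrow> \<Lambda> \<in> measurable M radon_space"

text \<open>
  Values on bounded sets are finite, so the real-valued \<open>measure\<close> loses nothing here.
\<close>

definition rm_le ::
  "(nat \<Rightarrow> ((nat \<Rightarrow> real) \<Rightarrow> real) \<Rightarrow> bool) \<Rightarrow> 'w measure \<Rightarrow> ('w \<Rightarrow> 'e::topological_space measure)
    \<Rightarrow> 'v measure \<Rightarrow> ('v \<Rightarrow> 'e measure) \<Rightarrow> bool" where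
  "rm_le \<FF> M \<Lambda>\<^sub>1 N \<Lambda>\<^sub>2 \<longleftrightarrow>
     field_le \<FF> bounded_borel M (\<lambda>\<omega>. measure (\<Lambda>\<^sub>1 \<omega>)) N (\<lambda>\<omega>. measure (\<Lambda>\<^sub>2 \<omega>))"

definition shot_noise ::
  "('e \<Rightarrow> 's \<Rightarrow> ennreal) \<Rightarrow> ('w \<Rightarrow> 'e measure) \<Rightarrow> 'w \<Rightarrow> 's \<Rightarrow> ennreal" where
  "shot_noise h \<Lambda> \<omega> y = (\<integral>\<^sup>+x. h x y \<partial>\<Lambda> \<omega>)"

end

theory Submission
  imports Defs
begin

text \<open>
  The integral \<open>V(y) = \<integral> h(x, y) \<Lambda>(dx)\<close> is an increasing limit of nonnegative linear combinations of
  masses \<open>\<Lambda>(B)\<close> of bounded Borel sets, and each of the three classes is stable under composition with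
  nonnegative linear maps.  So \<open>\<Lambda>\<^sub>1 \<le> \<Lambda>\<^sub>2\<close> compares the approximating vectors, and the work lies in the
  passage to the limit: the test function has to be continuous along the approximation, and there has
  to be an integrable majorant.

  \<^bold>\<open>Approximation.\<close>  Every measurable \<open>h : \<EE> \<rightarrow> [0,\<infinity>]\<close> is a series \<open>\<Sum>\<^sub>j 1\<^bsub>B j\<^esub> / (j + 1)\<close> with bounded Borel
  sets \<open>B j\<close>, chosen greedily (\<open>harmonic_indicator_series\<close>).  The weights are the same for all \<open>h\<close>, so
  the partial sums for several indices \<open>y\<close> have the same length and come from one linear map
  (\<open>rm_le_harmonic_mass\<close>).

  \<^bold>\<open>Continuity.\<close>  A Borel function that is directionally convex is midpoint convex in each coordinate,
  hence, by a theorem of Sierpinski, continuous and convex in each coordinate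
  (\<open>midpoint_convex_borel_continuous\<close>, \<open>midpoint_convex_borel_convex\<close>).  An increasing function with
  continuous sections converges along increasing sequences of points to its extension by monotone
  limits, even where coordinates of the limit are infinite (\<open>incseq_LIMSEQ_ext_mono\<close>).

  \<^bold>\<open>Majorant.\<close>  For increasing \<open>f\<close> the values at the approximations lie between \<open>f(0)\<close> and the extended
  value \<open>f(V)\<close>, which has finite expectation.  For \<open>f\<close> merely directionally convex, adding a suitable linear
  function makes \<open>f\<close> increasing on the nonnegative orthant (\<open>dcx_plus_linear_increasing\<close>); the linear
  part is controlled by the coordinates of \<open>V\<close>, which have finite means by hypothesis
  (\<open>dcx_limit_and_bound\<close>).  Dominated convergence finishes both cases (\<open>rm_le_limit\<close>).
\<close>

section \<open>Midpoint convex Borel functions on the line\<close>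

text \<open>
  For large \<open>N\<close> the set where \<open>\<phi> \<le> N\<close> fills more than three quarters of an interval of length \<open>2\<close>.  Then
  it meets its reflection in any point close to the centre, which makes that point the midpoint of two
  points with \<open>\<phi> \<le> N\<close>.
\<close>

lemma midpoint_convex_borel_bounded_near:
  fixes \<phi> :: "real \<Rightarrow> real"
  assumes mid: "\<And>x y. \<phi> ((x + y) / 2) \<le> (\<phi> x + \<phi> y) / 2"
    and [measurable]: "\<phi> \<in> borel_measurable borel"
  shows "\<exists>N. \<forall>t. \<bar>t\<bar> \<le> 1/4 \<longrightarrow> \<phi> (a + t) \<le> N"
proof -
  define A where "A k = {x \<in> {-1..1}. \<phi> (a + x) \<le> real k}" for k :: nat
  have A_sets[measurable]: "A k \<in> sets borel" for k
    unfolding A_def by measurable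
  have "incseq A" by (auto simp: A_def incseq_def)
  moreover have "(\<Union>k. A k) = {-1..1}"
    by (auto simp: A_def real_arch_simple)
  ultimately have "(\<lambda>k. emeasure lebesgue (A k)) \<longlonglongrightarrow> emeasure lebesgue {-1..1::real}"
    using Lim_emeasure_incseq[of A lebesgue] by (simp add: image_subset_iff sets_completionI_sets)
  then have "(\<lambda>k. emeasure lebesgue (A k)) \<longlonglongrightarrow> 2" by simp
  then have "\<forall>\<^sub>F k in sequentially. emeasure lebesgue (A k) > ennreal (3/2)"
    by (rule order_tendstoD) (simp add: ennreal_less_iff flip: ennreal_numeral)
  then obtain k where k: "emeasure lebesgue (A k) > ennreal (3/2)"
    by (auto simp: eventually_sequentially)
  have "\<phi> (a + t) \<le> real k" if t: "\<bar>t\<bar> \<le> 1/4" for t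
  proof -
    define R where "R = (\<lambda>x. -1 *\<^sub>R x + 2 * t) ` A k"
    have R: "emeasure lebesgue R = emeasure lebesgue (A k)"
      unfolding R_def by (subst emeasure_lebesgue_affine) simp
    have "R = (\<lambda>x. 2 * t - x) -` A k"
      by (force simp: R_def image_iff)
    then have R_sets: "R \<in> sets borel"
      using measurable_sets[OF _ A_sets, of "\<lambda>x. 2 * t - x" borel k] by simp
    \<comment> \<open>Both sets have measure above \<open>3/2\<close> and lie in an interval of length \<open>3\<close>.\<close>
    have "A k \<inter> R \<noteq> {}"
    proof
      assume disj: "A k \<inter> R = {}"
      have "ennreal 3 = ennreal (3/2) + ennreal (3/2)"
        by (simp flip: ennreal_plus)
      also have "\<dots> < emeasure lebesgue (A k) + emeasure lebesgue R"
        using k R by (intro add_strict_mono) auto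
      also have "\<dots> = emeasure lebesgue (A k \<union> R)"
        using disj R_sets by (intro plus_emeasure) auto
      also have "\<dots> \<le> emeasure lebesgue {-3/2..3/2::real}"
        using t by (intro emeasure_mono) (auto simp: A_def R_def abs_le_iff)
      finally show False by (simp add: ennreal_numeral)
    qed
    then obtain u where "u \<in> A k" "2 * t - u \<in> A k"
      by (auto simp: R_def)
    then have "\<phi> (a + u) \<le> real k" "\<phi> (a + (2 * t - u)) \<le> real k"
      by (auto simp: A_def)
    moreover have eq: "((a + u) + (a + (2 * t - u))) / 2 = a + t" by simp
    ultimately have "(\<phi> (a + u) + \<phi> (a + (2 * t - u))) / 2 \<le> (real k + real k) / 2"
      by (intro divide_right_mono add_mono) auto
    then show ?thesis
      using mid[of "a + u" "a + (2 * t - u)"] by (simp only: eq) simp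
  qed
  then show ?thesis by blast
qed

text \<open>
  Halving the increment halves the excess over \<open>\<phi> a\<close>, so an upper bound near \<open>a\<close> forces
  \<open>\<phi> (a + t) - \<phi> a\<close> to be small from above; the lower estimate follows by reflecting \<open>t\<close>.
\<close>

lemma midpoint_convex_borel_continuous:
  fixes \<phi> :: "real \<Rightarrow> real"
  assumes mid: "\<And>x y. \<phi> ((x + y) / 2) \<le> (\<phi> x + \<phi> y) / 2"
    and meas: "\<phi> \<in> borel_measurable borel"
  shows "isCont \<phi> a"
proof -
  obtain N where N: "\<And>t. \<bar>t\<bar> \<le> 1/4 \<Longrightarrow> \<phi> (a + t) \<le> N"
    using midpoint_convex_borel_bounded_near[OF mid meas, of a] by blast
  have upper: "\<phi> (a + t) - \<phi> a \<le> (N - \<phi> a) / 2 ^ k" if "2 ^ k * \<bar>t\<bar> \<le> 1/4" for k t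
    using that
  proof (induction k arbitrary: t)
    case 0
    then show ?case using N[of t] by simp
  next
    case (Suc k)
    have "\<phi> (a + t) - \<phi> a \<le> (\<phi> (a + 2 * t) - \<phi> a) / 2"
    proof -
      have eq: "((a + 2 * t) + a) / 2 = a + t" by simp
      have "p - r \<le> (q - r) / 2" if "p \<le> (q + r) / 2" for p q r :: real
        using that by simp
      from this[OF mid[of "a + 2 * t" a]] show ?thesis by (simp only: eq)
    qed
    also have "\<dots> \<le> (N - \<phi> a) / 2 ^ k / 2"
      using Suc.IH[of "2 * t"] Suc.prems by (intro divide_right_mono) (auto simp: abs_mult mult.assoc mult.left_commute)
    finally show ?case by (simp add: field_simps)
  qed
  have bound: "\<bar>\<phi> (a + t) - \<phi> a\<bar> \<le> (N - \<phi> a) / 2 ^ k" if "2 ^ k * \<bar>t\<bar> \<le> 1/4" for k t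
    using upper[of k t] upper[of k "- t"] mid[of "a + t" "a - t"] that by (auto simp: abs_le_iff)
  show ?thesis
    unfolding isCont_def LIM_eq
  proof (intro allI impI)
    fix e :: real assume e: "0 < e"
    have "(\<lambda>k. (N - \<phi> a) * (1/2) ^ k) \<longlonglongrightarrow> (N - \<phi> a) * 0"
      by (intro tendsto_intros LIMSEQ_power_zero) auto
    then have "\<forall>\<^sub>F k in sequentially. (N - \<phi> a) * (1/2) ^ k < e"
      using e by (intro order_tendstoD) auto
    then obtain k where k: "(N - \<phi> a) * (1/2) ^ k < e"
      by (auto simp: eventually_sequentially)
    show "\<exists>s>0. \<forall>x. x \<noteq> a \<and> norm (x - a) < s \<longrightarrow> norm (\<phi> x - \<phi> a) < e"
    proof (intro exI[of _ "1 / (4 * 2 ^ k)"] conjI allI impI)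
      fix x assume "x \<noteq> a \<and> norm (x - a) < 1 / (4 * 2 ^ k)"
      then have "2 ^ k * \<bar>x - a\<bar> \<le> 1/4" by (simp add: field_simps)
      from bound[OF this] k show "norm (\<phi> x - \<phi> a) < e"
        by (simp add: power_divide)
    qed simp
  qed
qed

text \<open>
  A positive maximum would be attained at a least point \<open>c\<close> strictly between the ends; the values at
  \<open>c - d\<close> and \<open>c + d\<close> then average to less than the value at \<open>c\<close>.
\<close>

lemma midpoint_convex_continuous_chord_bound:
  fixes \<psi> :: "real \<Rightarrow> real"
  assumes mid: "\<And>x y. \<psi> ((x + y) / 2) \<le> (\<psi> x + \<psi> y) / 2"
    and cont: "continuous_on {0..1} \<psi>" and ends: "\<psi> 0 = 0" "\<psi> 1 = 0"
    and u: "u \<in> {0..1}"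
  shows "\<psi> u \<le> 0"
proof (rule ccontr)
  assume "\<not> \<psi> u \<le> 0"
  obtain m where m: "m \<in> {0..1}" "\<And>x. x \<in> {0..1} \<Longrightarrow> \<psi> x \<le> \<psi> m"
    using continuous_attains_sup[OF _ _ cont] by fastforce
  define C where "C = {x \<in> {0..1}. \<psi> x \<in> {\<psi> m}}"
  have "closed C"
    unfolding C_def by (rule continuous_closed_preimage[OF cont, simplified vimage_def Int_def mem_Collect_eq]) auto
  moreover have "C \<subseteq> {0..1}" by (auto simp: C_def)
  ultimately have "compact C"
    using compact_Int_closed[of "{0..1}" C] by (simp add: Int_absorb1)
  moreover have "C \<noteq> {}" using m by (auto simp: C_def)
  ultimately have "\<exists>c\<in>C. \<forall>x\<in>C. c \<le> x"
    by (rule compact_attains_inf)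
  then obtain c where c: "c \<in> C" "\<And>x. x \<in> C \<Longrightarrow> c \<le> x"
    by auto
  have pos: "0 < \<psi> m" using m(2)[OF u] \<open>\<not> \<psi> u \<le> 0\<close> by simp
  have c01: "0 < c" "c < 1"
    using c(1) ends pos by (auto simp: C_def less_le)
  define d where "d = min c (1 - c)"
  have d: "0 < d" "c - d \<in> {0..1}" "c + d \<in> {0..1}" using c01 by (auto simp: d_def)
  have "\<psi> (c - d) \<noteq> \<psi> m" using c(2)[of "c - d"] d by (auto simp: C_def)
  then have "\<psi> (c - d) < \<psi> m" using m(2)[OF d(2)] by simp
  moreover have "\<psi> (c + d) \<le> \<psi> m" using m(2)[OF d(3)] .
  moreover have "\<psi> c = \<psi> m" using c(1) by (simp add: C_def)
  ultimately show False using mid[of "c - d" "c + d"] by simp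
qed

lemma midpoint_convex_borel_convex:
  fixes \<phi> :: "real \<Rightarrow> real"
  assumes mid: "\<And>x y. \<phi> ((x + y) / 2) \<le> (\<phi> x + \<phi> y) / 2"
    and meas: "\<phi> \<in> borel_measurable borel"
  shows "convex_on UNIV \<phi>"
proof (rule convex_onI)
  fix u x y :: real assume u: "0 < u" "u < 1"
  define \<psi> where "\<psi> v = \<phi> ((1 - v) * x + v * y) - ((1 - v) * \<phi> x + v * \<phi> y)" for v
  have cont: "continuous_on UNIV \<phi>"
    using midpoint_convex_borel_continuous[OF mid meas] by (simp add: continuous_at_imp_continuous_on)
  have "\<psi> u \<le> 0"
  proof (rule midpoint_convex_continuous_chord_bound[where \<psi> = \<psi>])
    show "continuous_on {0..1} \<psi>"
      unfolding \<psi>_def by (intro continuous_intros continuous_on_compose2[OF cont]) auto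
    show "\<psi> ((v + w) / 2) \<le> (\<psi> v + \<psi> w) / 2" for v w
    proof -
      have eq: "(1 - (v + w) / 2) * x + (v + w) / 2 * y
          = (((1 - v) * x + v * y) + ((1 - w) * x + w * y)) / 2" for x y
        by (simp add: algebra_simps add_divide_distrib diff_divide_distrib)
      have "p - (c + d) / 2 \<le> (q - c + (r - d)) / 2" if "p \<le> (q + r) / 2" for p q r c d :: real
        using that by (simp add: field_simps)
      from this[OF mid] show ?thesis unfolding \<psi>_def eq .
    qed
  qed (use u in \<open>auto simp: \<psi>_def\<close>)
  then show "\<phi> ((1 - u) *\<^sub>R x + u *\<^sub>R y) \<le> (1 - u) * \<phi> x + u * \<phi> y"
    by (simp add: \<psi>_def)
qed simp

section \<open>Directionally convex functions coordinate by coordinate\<close>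

lemma restrict_in_Rn: "(\<lambda>i\<in>{..<n}. x i) \<in> space (Rn n)"
  by (simp add: Rn_def space_PiM)

lemma fun_upd_in_Rn: "x \<in> space (Rn n) \<Longrightarrow> i < n \<Longrightarrow> x(i := t) \<in> space (Rn n)"
  by (auto simp: Rn_def space_PiM PiE_def extensional_def)

lemma Rn_ext: "x \<in> space (Rn n) \<Longrightarrow> y \<in> space (Rn n) \<Longrightarrow> (\<And>i. i < n \<Longrightarrow> x i = y i) \<Longrightarrow> x = y"
  unfolding Rn_def space_PiM by (rule PiE_ext) auto

lemma measurable_restrict_Rn:
  assumes "\<And>i. i < n \<Longrightarrow> (\<lambda>\<omega>. v \<omega> i) \<in> borel_measurable M"
  shows "(\<lambda>\<omega>. \<lambda>i\<in>{..<n}. v \<omega> i) \<in> measurable M (Rn n)"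
  unfolding Rn_def using assms by (intro measurable_restrict) auto

text \<open>
  Of the order conditions in the definition only those on \<open>p\<close> need checking: the ones on \<open>q\<close> follow from the
  equality of the sums.
\<close>

lemma dcxD:
  assumes "dcx n f" "x \<in> space (Rn n)" "y \<in> space (Rn n)" "p \<in> space (Rn n)" "q \<in> space (Rn n)"
    and "\<And>i. i < n \<Longrightarrow> p i \<le> x i" "\<And>i. i < n \<Longrightarrow> p i \<le> y i"
    and "\<And>i. i < n \<Longrightarrow> x i + y i = p i + q i"
  shows "f x + f y \<le> f p + f q"
proof -
  have "x i \<le> q i" "y i \<le> q i" if "i < n" for i
    using assms(6-8)[OF that] by auto
  then show ?thesis using assms unfolding dcx_def vle_def by blast
qed

lemma measurable_section:
  assumes f: "f \<in> borel_measurable (Rn n)" and x: "x \<in> space (Rn n)" "i < n"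
  shows "(\<lambda>t. f (x(i := t))) \<in> borel_measurable borel"
proof (rule measurable_compose[OF _ f])
  have "(\<lambda>t. \<lambda>j\<in>{..<n}. (x(i := t)) j) \<in> borel \<rightarrow>\<^sub>M Rn n"
    by (intro measurable_restrict_Rn) (auto simp: fun_upd_def)
  moreover have "(\<lambda>j\<in>{..<n}. (x(i := t)) j) = x(i := t)" for t
    using fun_upd_in_Rn[OF x] by (intro Rn_ext[OF restrict_in_Rn]) auto
  ultimately show "(\<lambda>t. x(i := t)) \<in> borel \<rightarrow>\<^sub>M Rn n" by simp
qed

text \<open>
  The definition with \<open>x = y\<close> the midpoint of \<open>p\<close> and \<open>q\<close>, which differ in the coordinate \<open>i\<close> alone.
\<close>

lemma dcx_section_midpoint:
  assumes f: "dcx n f" and x: "x \<in> space (Rn n)" "i < n"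
  shows "f (x(i := (s + t) / 2)) \<le> (f (x(i := s)) + f (x(i := t))) / 2"
proof -
  have *: "f (x(i := (s + t) / 2)) \<le> (f (x(i := s)) + f (x(i := t))) / 2" if "s \<le> t" for s t :: real
  proof -
    have "f (x(i := (s + t) / 2)) + f (x(i := (s + t) / 2)) \<le> f (x(i := s)) + f (x(i := t))"
      using that by (intro dcxD[OF f]) (auto simp: fun_upd_in_Rn x)
    then show ?thesis by simp
  qed
  show ?thesis using *[of s t] *[of t s] by (cases "s \<le> t") (auto simp: add.commute)
qed

lemma dcx_section_continuous:
  assumes "dcx n f" "f \<in> borel_measurable (Rn n)" "x \<in> space (Rn n)" "i < n"
  shows "isCont (\<lambda>t. f (x(i := t))) a"
  using assms by (intro midpoint_convex_borel_continuous dcx_section_midpoint measurable_section)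

lemma dcv_section_continuous:
  assumes "dcv n f" "f \<in> borel_measurable (Rn n)" "x \<in> space (Rn n)" "i < n"
  shows "isCont (\<lambda>t. f (x(i := t))) a"
proof -
  have "dcx n (\<lambda>x. - f x)"
    unfolding dcx_def
  proof (intro ballI impI)
    fix x y p q
    assume "x \<in> space (Rn n)" "y \<in> space (Rn n)" "p \<in> space (Rn n)" "q \<in> space (Rn n)"
      "vle n p x \<and> vle n p y \<and> vle n x q \<and> vle n y q \<and> (\<forall>i<n. x i + y i = p i + q i)"
    then have "f p + f q \<le> f x + f y" using assms(1) unfolding dcv_def by blast
    then show "- f x + - f y \<le> - f p + - f q" by simp
  qed
  from dcx_section_continuous[OF this _ assms(3,4), of a] assms(2)
  have "isCont (\<lambda>t. - f (x(i := t))) a" by simp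
  then show ?thesis using isCont_minus by fastforce
qed

lemma increasing_funD:
  "increasing_fun n f \<Longrightarrow> x \<in> space (Rn n) \<Longrightarrow> y \<in> space (Rn n) \<Longrightarrow> (\<And>i. i < n \<Longrightarrow> x i \<le> y i) \<Longrightarrow> f x \<le> f y"
  by (auto simp: increasing_fun_def vle_def)

text \<open>
  Continuity in each variable separately is enough for monotone functions: the coordinates are lowered
  one after the other, keeping the value above \<open>a\<close>, and monotonicity takes care of all points above the
  final corner.
\<close>

lemma increasing_left_continuous:
  assumes incr: "increasing_fun n f"
    and sect: "\<And>x i. x \<in> space (Rn n) \<Longrightarrow> i < n \<Longrightarrow> isCont (\<lambda>t. f (x(i := t))) (x i)"
    and x: "x \<in> space (Rn n)" and a: "a < f x"
  shows "\<exists>\<delta>>0. \<forall>y\<in>space (Rn n). (\<forall>i<n. x i - \<delta> \<le> y i) \<longrightarrow> a < f y"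
proof -
  define z where "z k \<delta> = (\<lambda>i\<in>{..<n}. if i < k then x i - \<delta> else x i)" for k \<delta>
  have z: "z k \<delta> \<in> space (Rn n)" for k \<delta>
    unfolding z_def by (rule restrict_in_Rn)
  have "k \<le> n \<Longrightarrow> \<exists>\<delta>>0. a < f (z k \<delta>)" for k
  proof (induction k)
    case 0
    have "z 0 1 = x" using x by (intro Rn_ext[OF z]) (auto simp: z_def)
    with a show ?case by (intro exI[of _ 1]) auto
  next
    case (Suc k)
    then obtain \<delta>\<^sub>1 where \<delta>\<^sub>1: "0 < \<delta>\<^sub>1" "a < f (z k \<delta>\<^sub>1)" by auto
    have "((\<lambda>t. f ((z k \<delta>\<^sub>1)(k := t))) \<longlongrightarrow> f (z k \<delta>\<^sub>1)) (at (x k))"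
      using sect[OF z, of k k \<delta>\<^sub>1] Suc.prems by (simp add: isCont_def z_def fun_upd_idem)
    then have "\<forall>\<^sub>F t in at (x k). a < f ((z k \<delta>\<^sub>1)(k := t))"
      using \<delta>\<^sub>1(2) by (rule order_tendstoD)
    then obtain d where d: "0 < d" "\<And>t. t \<noteq> x k \<Longrightarrow> dist t (x k) < d \<Longrightarrow> a < f ((z k \<delta>\<^sub>1)(k := t))"
      by (auto simp: eventually_at)
    define \<delta> where "\<delta> = min \<delta>\<^sub>1 (d / 2)"
    have "a < f ((z k \<delta>\<^sub>1)(k := x k - \<delta>))"
      using d \<delta>\<^sub>1 by (intro d(2)) (auto simp: \<delta>_def dist_real_def)
    also have "\<dots> \<le> f (z (Suc k) \<delta>)"
      using Suc.prems by (intro increasing_funD[OF incr] fun_upd_in_Rn z) (auto simp: z_def \<delta>_def)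
    finally show ?case using d \<delta>\<^sub>1 by (intro exI[of _ \<delta>]) (auto simp: \<delta>_def)
  qed
  then obtain \<delta> where \<delta>: "0 < \<delta>" "a < f (z n \<delta>)" by blast
  show ?thesis
  proof (intro exI[of _ \<delta>] conjI ballI impI \<delta>(1))
    fix y assume y: "y \<in> space (Rn n)" "\<forall>i<n. x i - \<delta> \<le> y i"
    have "f (z n \<delta>) \<le> f y"
      using y by (intro increasing_funD[OF incr z]) (auto simp: z_def)
    with \<delta> show "a < f y" by simp
  qed
qed

section \<open>Making a directionally convex function increasing\<close>

lemma dcx_section_convex:
  assumes "dcx n f" "f \<in> borel_measurable (Rn n)" "x \<in> space (Rn n)" "i < n"
  shows "convex_on UNIV (\<lambda>t. f (x(i := t)))"
  using assms by (intro midpoint_convex_borel_convex dcx_section_midpoint measurable_section)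

text \<open>
  On the axes this is convexity, with \<open>c i\<close> the negative of the slope over \<open>[-1, 0]\<close>: a directionally
  convex function is defined to the left of \<open>0\<close> as well, so its right slopes at \<open>0\<close> are not \<open>-\<infinity>\<close>.  From
  the axes the bound spreads to the orthant, because directional convexity makes the increments from \<open>0\<close>
  superadditive.
\<close>

lemma dcx_lower_bound_orthant:
  assumes f: "dcx n f" "f \<in> borel_measurable (Rn n)"
  obtains c where "\<And>d. d \<in> space (Rn n) \<Longrightarrow> (\<And>i. i < n \<Longrightarrow> 0 \<le> d i)
    \<Longrightarrow> f (\<lambda>i\<in>{..<n}. 0) \<le> f d + (\<Sum>i<n. c i * d i)"
proof
  define z :: "nat \<Rightarrow> real" where "z = (\<lambda>i\<in>{..<n}. 0)"
  have z: "z \<in> space (Rn n)" unfolding z_def by (rule restrict_in_Rn)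
  define c where "c i = f (z(i := -1)) - f z" for i
  have single: "f z \<le> f (z(i := t)) + c i * t" if "i < n" "0 \<le> t" for i t
  proof -
    \<comment> \<open>Convexity at \<open>0\<close>, between \<open>-1\<close> and \<open>t\<close>.\<close>
    have "f (z(i := (1 - 1 / (1 + t)) *\<^sub>R (-1) + (1 / (1 + t)) *\<^sub>R t))
        \<le> (1 - 1 / (1 + t)) * f (z(i := -1)) + 1 / (1 + t) * f (z(i := t))"
      using convex_onD[OF dcx_section_convex[OF f z \<open>i < n\<close>], of "1 / (1 + t)" "-1" t] \<open>0 \<le> t\<close> by simp
    moreover have "(1 - 1 / (1 + t)) *\<^sub>R (-1) + (1 / (1 + t)) *\<^sub>R t = 0"
      using \<open>0 \<le> t\<close> by (simp add: divide_simps)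
    moreover have "z(i := 0) = z" using \<open>i < n\<close> by (simp add: z_def fun_upd_idem)
    ultimately have "f z \<le> (1 - 1 / (1 + t)) * f (z(i := -1)) + 1 / (1 + t) * f (z(i := t))"
      by simp
    then have "(1 + t) * f z \<le> (1 + t) * ((1 - 1 / (1 + t)) * f (z(i := -1)) + 1 / (1 + t) * f (z(i := t)))"
      using \<open>0 \<le> t\<close> by (intro mult_left_mono) auto
    also have "\<dots> = ((1 + t) * (1 - 1 / (1 + t))) * f (z(i := -1)) + ((1 + t) * (1 / (1 + t))) * f (z(i := t))"
      by (simp only: distrib_left mult.assoc)
    also have "\<dots> = t * f (z(i := -1)) + 1 * f (z(i := t))"
    proof -
      have "(1 + t) * (1 - 1 / (1 + t)) = t" "(1 + t) * (1 / (1 + t)) = 1"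
        using \<open>0 \<le> t\<close> by (auto simp: right_diff_distrib)
      then show ?thesis by (simp only:)
    qed
    finally show ?thesis by (simp add: c_def algebra_simps)
  qed
  fix d assume d: "d \<in> space (Rn n)" "\<And>i. i < n \<Longrightarrow> 0 \<le> d i"
  \<comment> \<open>The coordinates of \<open>d\<close> are switched on one after the other.\<close>
  define D where "D k = (\<lambda>i\<in>{..<n}. if i < k then d i else 0)" for k
  have D: "D k \<in> space (Rn n)" for k unfolding D_def by (rule restrict_in_Rn)
  have "k \<le> n \<Longrightarrow> f z \<le> f (D k) + (\<Sum>i<k. c i * d i)" for k
  proof (induction k)
    case 0
    then show ?case by (simp add: D_def z_def)
  next
    case (Suc k)
    \<comment> \<open>Directional convexity between \<open>z\<close> and \<open>D (Suc k) = D k + z(k := d k)\<close>.\<close>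
    have "f (D k) + f (z(k := d k)) \<le> f z + f (D (Suc k))"
      using Suc.prems by (intro dcxD[OF f(1)] D z fun_upd_in_Rn) (auto simp: D_def z_def d)
    with Suc single[of k "d k"] d(2)[of k] show ?case by simp
  qed
  from this[of n] have "f z \<le> f (D n) + (\<Sum>i<n. c i * d i)" by simp
  moreover have "D n = d" using d(1) by (intro Rn_ext[OF D]) (auto simp: D_def)
  ultimately show "f (\<lambda>i\<in>{..<n}. 0) \<le> f d + (\<Sum>i<n. c i * d i)" by (simp add: z_def)
qed

definition pos_part :: "nat \<Rightarrow> (nat \<Rightarrow> real) \<Rightarrow> nat \<Rightarrow> real" where
  "pos_part n x = (\<lambda>i\<in>{..<n}. max 0 (x i))"

text \<open>
  The increment of \<open>f\<close> from \<open>x\<close> to \<open>y\<close> in the orthant is at least its increment from \<open>0\<close> to \<open>y - x\<close>, which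
  the lower bound on the orthant controls linearly.  Composing with the positive part turns the statement
  on the orthant into one about all of \<open>\<real>\<^sup>n\<close>.
\<close>

lemma dcx_plus_linear_increasing:
  assumes f: "dcx n f" "f \<in> borel_measurable (Rn n)"
  obtains c where "increasing_fun n (\<lambda>x. f (pos_part n x) + (\<Sum>i<n. c i * max 0 (x i)))"
proof -
  obtain c where c: "\<And>d. d \<in> space (Rn n) \<Longrightarrow> (\<And>i. i < n \<Longrightarrow> 0 \<le> d i)
      \<Longrightarrow> f (\<lambda>i\<in>{..<n}. 0) \<le> f d + (\<Sum>i<n. c i * d i)"
    using dcx_lower_bound_orthant[OF f] by metis
  have "increasing_fun n (\<lambda>x. f (pos_part n x) + (\<Sum>i<n. c i * max 0 (x i)))"
    unfolding increasing_fun_def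
  proof (intro ballI impI)
    fix x y assume "vle n x y"
    define d where "d = (\<lambda>i\<in>{..<n}. max 0 (y i) - max 0 (x i))"
    have xy: "x i \<le> y i" if "i < n" for i
      using \<open>vle n x y\<close> that by (simp add: vle_def)
    have d_nonneg: "0 \<le> d i" if "i < n" for i
      using that by (simp add: d_def max.coboundedI2 xy)
    have d: "f (\<lambda>i\<in>{..<n}. 0) \<le> f d + (\<Sum>i<n. c i * d i)"
      using d_nonneg by (intro c) (simp_all add: d_def restrict_in_Rn)
    have "f (pos_part n x) + f d \<le> f (\<lambda>i\<in>{..<n}. 0) + f (pos_part n y)"
      by (intro dcxD[OF f(1)])
        (simp_all add: pos_part_def d_def restrict_in_Rn max.coboundedI2 xy)
    moreover have "(\<Sum>i<n. c i * d i) = (\<Sum>i<n. c i * max 0 (y i)) - (\<Sum>i<n. c i * max 0 (x i))"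
      by (simp add: d_def algebra_simps flip: sum_subtractf)
    ultimately show "f (pos_part n x) + (\<Sum>i<n. c i * max 0 (x i))
        \<le> f (pos_part n y) + (\<Sum>i<n. c i * max 0 (y i))"
      using d by simp
  qed
  then show thesis by (rule that)
qed

lemma pos_part_plus_linear_section_continuous:
  assumes f: "\<And>x i a. x \<in> space (Rn n) \<Longrightarrow> i < n \<Longrightarrow> isCont (\<lambda>t. f (x(i := t))) a"
    and x: "x \<in> space (Rn n)" "i < n"
  shows "isCont (\<lambda>t. f (pos_part n (x(i := t))) + (\<Sum>j<n. c j * max 0 ((x(i := t)) j))) a"
proof -
  have upd: "pos_part n (x(i := t)) = (pos_part n x)(i := max 0 t)" for t
    using x(2) by (auto simp: pos_part_def fun_eq_iff)
  have "isCont (\<lambda>t. f ((pos_part n x)(i := max 0 t))) a"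
    by (rule isCont_o2[OF _ f]) (auto simp: pos_part_def restrict_in_Rn x(2) intro!: continuous_intros)
  moreover have "isCont (\<lambda>t. \<Sum>j<n. c j * max 0 ((x(i := t)) j)) a"
  proof (intro continuous_intros)
    fix j show "isCont (\<lambda>t. (x(i := t)) j) a" by (cases "j = i") auto
  qed
  ultimately show ?thesis unfolding upd by (rule continuous_add)
qed

section \<open>Extension by monotone limits\<close>

text \<open>
  The extension by monotone limits is defined along the truncations \<open>V \<and> m\<close>, but any finite sequence
  increasing to \<open>V\<close> gives it.  Each \<open>v k\<close> lies below some truncation; conversely each truncation is
  nearly reached by the \<open>v k\<close>, so that left continuity applies.
\<close>

lemma incseq_LIMSEQ_ext_mono:
  assumes incr: "increasing_fun n f"
    and sect: "\<And>x i. x \<in> space (Rn n) \<Longrightarrow> i < n \<Longrightarrow> isCont (\<lambda>t. f (x(i := t))) (x i)"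
    and v: "\<And>k. v k \<in> space (Rn n)" "\<And>k i. i < n \<Longrightarrow> 0 \<le> v k i" "\<And>i. i < n \<Longrightarrow> incseq (\<lambda>k. v k i)"
    and V: "\<And>i. i < n \<Longrightarrow> (SUP k. ennreal (v k i)) = V i"
  shows "ereal (f (v k)) \<le> ext_mono n f V"
    and "(\<lambda>k. ereal (f (v k))) \<longlonglongrightarrow> ext_mono n f V"
proof -
  define t where "t m = (\<lambda>i\<in>{..<n}. enn2real (min (V i) (of_nat m)))" for m :: nat
  have t: "t m \<in> space (Rn n)" for m unfolding t_def by (rule restrict_in_Rn)
  have ext: "ext_mono n f V = (SUP m. ereal (f (t m)))" by (simp add: ext_mono_def t_def)
  have t_ennreal: "ennreal (t m i) = min (V i) (of_nat m)" if "i < n" for m i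
  proof -
    have "min (V i) (of_nat m) < top"
      using of_nat_less_top by (rule min.strict_coboundedI2)
    then show ?thesis using that by (simp add: t_def)
  qed
  have inc: "incseq (\<lambda>k. ereal (f (v k)))"
    using v by (auto simp: incseq_def intro!: increasing_funD[OF incr])
  show upper: "ereal (f (v k)) \<le> ext_mono n f V" for k
  proof -
    obtain m :: nat where m: "Max (insert 0 (v k ` {..<n})) \<le> real m"
      using real_arch_simple by blast
    have "v k i \<le> t m i" if i: "i < n" for i
    proof -
      have "ennreal (v k i) \<le> V i" unfolding V[OF i, symmetric] by (rule SUP_upper) simp
      moreover have "ennreal (v k i) \<le> of_nat m"
        using m i by (simp add: ennreal_of_nat_eq_real_of_nat ennreal_leI)
      ultimately have "ennreal (v k i) \<le> ennreal (t m i)" by (simp add: t_ennreal i)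
      then show ?thesis using i by (simp add: ennreal_le_iff t_def)
    qed
    then have "f (v k) \<le> f (t m)" by (intro increasing_funD[OF incr v(1) t])
    then show ?thesis unfolding ext by (intro SUP_upper2[of m]) auto
  qed
  have "ext_mono n f V \<le> (SUP k. ereal (f (v k)))"
    unfolding ext
  proof (rule SUP_least, rule ccontr)
    fix m assume "\<not> ereal (f (t m)) \<le> (SUP k. ereal (f (v k)))"
    then have "(SUP k. ereal (f (v k))) < ereal (f (t m))" by (simp only: not_le)
    then obtain a where a: "(SUP k. ereal (f (v k))) < ereal a" "ereal a < ereal (f (t m))"
      using ereal_dense2 by metis
    obtain \<delta> where \<delta>: "0 < \<delta>" "\<And>y. y \<in> space (Rn n) \<Longrightarrow> (\<And>i. i < n \<Longrightarrow> t m i - \<delta> \<le> y i) \<Longrightarrow> a < f y"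
      using increasing_left_continuous[OF incr sect t, of a m] a(2) by auto
    have "\<forall>\<^sub>F k in sequentially. t m i - \<delta> \<le> v k i" if i: "i < n" for i
    proof (cases "t m i - \<delta> < 0")
      case True
      then have "t m i - \<delta> \<le> v k i" for k using v(2)[OF i, of k] by simp
      then show ?thesis by (intro always_eventually allI)
    next
      case False
      have "ennreal (t m i - \<delta>) < ennreal (t m i)"
        using False \<delta>(1) by (intro ennreal_lessI) auto
      also have "\<dots> \<le> V i" by (simp add: t_ennreal i)
      finally obtain k where k: "ennreal (t m i - \<delta>) < ennreal (v k i)"
        unfolding V[OF i, symmetric] less_SUP_iff by blast
      then have "t m i - \<delta> \<le> v k i" using False by (simp add: ennreal_less_iff)
      then have "t m i - \<delta> \<le> v k' i" if "k' \<ge> k" for k'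
        using incseqD[OF v(3)[OF i] that] by simp
      then show ?thesis by (auto simp: eventually_sequentially)
    qed
    then have "\<forall>\<^sub>F k in sequentially. \<forall>i\<in>{..<n}. t m i - \<delta> \<le> v k i"
      by (intro eventually_ball_finite) auto
    then obtain k where "\<And>i. i < n \<Longrightarrow> t m i - \<delta> \<le> v k i"
      by (auto simp: eventually_sequentially)
    then have "a < f (v k)" by (intro \<delta>(2) v)
    also have "ereal (f (v k)) \<le> (SUP k. ereal (f (v k)))" by (rule SUP_upper) simp
    finally show False using a(1) by simp
  qed
  moreover have "(SUP k. ereal (f (v k))) \<le> ext_mono n f V"
    using upper by (rule SUP_least)
  ultimately show "(\<lambda>k. ereal (f (v k))) \<longlonglongrightarrow> ext_mono n f V"
    using LIMSEQ_SUP[OF inc] by simp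
qed

section \<open>Series of indicators with harmonic weights\<close>

text \<open>
  A partial sum of the harmonic series that skips every term which would exceed \<open>h x\<close>.  The sets \<open>U k\<close>
  localize the terms: where they are relatively compact, so are the supports of the steps.
\<close>

primrec greedy_sum :: "(nat \<Rightarrow> 'e set) \<Rightarrow> ('e \<Rightarrow> ennreal) \<Rightarrow> nat \<Rightarrow> 'e \<Rightarrow> ennreal" where
  "greedy_sum U h 0 x = 0"
| "greedy_sum U h (Suc k) x = greedy_sum U h k x +
     (if x \<in> U k \<and> greedy_sum U h k x + ennreal (1 / real (Suc k)) \<le> h x
      then ennreal (1 / real (Suc k)) else 0)"

lemma greedy_sum_le: "greedy_sum U h k x \<le> h x"
  by (induction k) auto

lemma suminf_harmonic_shift_ennreal: "(\<Sum>j. ennreal (1 / real (Suc (j + K)))) = \<top>"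
proof (rule ccontr)
  assume "(\<Sum>j. ennreal (1 / real (Suc (j + K)))) \<noteq> \<top>"
  then have "summable (\<lambda>j. 1 / real (Suc (j + K)))"
    by (intro summable_suminf_not_top) auto
  then have "summable (\<lambda>j. inverse (real (j + Suc K)))"
    by (simp add: inverse_eq_divide)
  then show False
    using not_summable_harmonic[where 'a = real] summable_iff_shift[of "\<lambda>n. inverse (real n)" "Suc K"] by blast
qed

text \<open>
  If the \<open>k\<close>-th harmonic weight is accepted at \<open>x\<close> from some \<open>k\<close> on, the sum diverges, and \<open>h x = \<infinity>\<close>.
  Otherwise it is refused infinitely often at indices with \<open>x \<in> U k\<close>, and each refusal means that the
  remainder is less than \<open>1 / (k + 1)\<close>.
\<close>

lemma SUP_greedy_sum:
  assumes U: "incseq U" "(\<Union>k. U k) = UNIV"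
  shows "(SUP k. greedy_sum U h k x) = h x"
proof (rule antisym)
  let ?s = "\<lambda>k. greedy_sum U h k x"
  let ?take = "\<lambda>k. x \<in> U k \<and> ?s k + ennreal (1 / real (Suc k)) \<le> h x"
  show "(SUP k. ?s k) \<le> h x" by (intro SUP_least greedy_sum_le)
  show "h x \<le> (SUP k. ?s k)"
  proof (cases "\<exists>K. \<forall>k\<ge>K. ?take k")
    case True
    then obtain K where K: "\<And>k. k \<ge> K \<Longrightarrow> ?take k" by blast
    have "(\<Sum>j<m. ennreal (1 / real (Suc (j + K)))) \<le> ?s (m + K)" for m
    proof (induction m)
      case (Suc m)
      then show ?case using K[of "m + K"] by (auto intro: add_mono)
    qed simp
    then have "(SUP m. \<Sum>j<m. ennreal (1 / real (Suc (j + K)))) \<le> (SUP k. ?s k)"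
      by (intro SUP_least) (blast intro: SUP_upper2)
    then have "(SUP k. ?s k) = \<top>"
      using suminf_harmonic_shift_ennreal[of K] unfolding suminf_eq_SUP by (simp only: top_unique)
    then show ?thesis by (simp only: top_greatest)
  next
    case False
    obtain K where K: "x \<in> U K" using U(2) by blast
    show ?thesis
    proof (rule ennreal_le_epsilon)
      fix e :: real assume e: "0 < e"
      obtain N where N: "1 / real (Suc N) < e" using e nat_approx_posE by blast
      obtain k where k: "k \<ge> max K N" "\<not> ?take k" using False by blast
      have "x \<in> U k" using K incseqD[OF U(1)] k(1) by auto
      then have "h x \<le> ?s k + ennreal (1 / real (Suc k))" using k(2) by auto
      also have "\<dots> \<le> (SUP k. ?s k) + ennreal e"
      proof (intro add_mono SUP_upper ennreal_leI)
        have "1 / real (Suc k) \<le> 1 / real (Suc N)" using k(1) by (simp add: frac_le)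
        then show "1 / real (Suc k) \<le> e" using N by simp
      qed simp
      finally show "h x \<le> (SUP k. ?s k) + ennreal e" .
    qed
  qed
qed

lemma measurable_greedy_sum:
  fixes h :: "'e::topological_space \<Rightarrow> ennreal" and U :: "nat \<Rightarrow> 'e set"
  assumes [measurable]: "h \<in> borel_measurable borel" "\<And>k. U k \<in> sets borel"
  shows "greedy_sum U h k \<in> borel_measurable borel"
proof (induction k)
  case 0
  have "greedy_sum U h 0 = (\<lambda>x. 0)" by auto
  then show ?case by simp
next
  case (Suc k)
  note [measurable] = Suc
  have "greedy_sum U h (Suc k) = (\<lambda>x. greedy_sum U h k x +
     (if x \<in> U k \<and> greedy_sum U h k x + ennreal (1 / real (Suc k)) \<le> h x
      then ennreal (1 / real (Suc k)) else 0))" by auto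
  then show ?case by simp
qed

lemma bounded_borel_subset:
  fixes A :: "'e::t2_space set"
  assumes "B \<in> bounded_borel" "A \<in> sets borel" "A \<subseteq> B"
  shows "A \<in> bounded_borel"
proof -
  have "compact (closure B \<inter> closure A)"
    using assms by (intro compact_Int_closed) (auto simp: bounded_borel_def)
  then show ?thesis
    using assms closure_mono[of A B] by (auto simp: bounded_borel_def Int_absorb1)
qed

text \<open>
  The point of the fixed weights \<open>1 / (j + 1)\<close> is that they do not depend on \<open>h\<close>: only the sets do.
\<close>

lemma harmonic_indicator_series:
  fixes h :: "'e::t2_space \<Rightarrow> ennreal" and U :: "nat \<Rightarrow> 'e set"
  assumes h: "h \<in> borel_measurable borel"
    and U: "incseq U" "(\<Union>k. U k) = UNIV" "\<And>k. U k \<in> bounded_borel"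
  shows "\<exists>B. (\<forall>j. B j \<in> bounded_borel) \<and>
    (\<forall>x. (SUP k. \<Sum>j<k. ennreal (1 / real (Suc j)) * indicator (B j) x) = h x)"
proof -
  define B where "B j = {x \<in> U j. greedy_sum U h j x + ennreal (1 / real (Suc j)) \<le> h x}" for j
  have U_sets[measurable]: "U k \<in> sets borel" for k
    using U(3) by (auto simp: bounded_borel_def)
  note [measurable] = h measurable_greedy_sum[OF h U_sets]
  have "B j \<in> sets borel" for j
    unfolding B_def by measurable
  then have "B j \<in> bounded_borel" for j
    by (rule bounded_borel_subset[OF U(3)]) (auto simp: B_def)
  moreover have "(\<Sum>j<k. ennreal (1 / real (Suc j)) * indicator (B j) x) = greedy_sum U h k x" for k x
    by (induction k) (auto simp: B_def)
  ultimately show ?thesis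
    using SUP_greedy_sum[OF U(1,2), of h] by (intro exI[of _ B]) (simp only: simp_thms)
qed

lemma bounded_borel_exhaustion:
  assumes "locally_compact_space (euclidean :: 'e::{second_countable_topology, t2_space} topology)"
  obtains U :: "nat \<Rightarrow> 'e::{second_countable_topology, t2_space} set" where "incseq U" "(\<Union>k. U k) = UNIV" "\<And>k. U k \<in> bounded_borel"
proof -
  have compact_closure: "compact (closure V)" if "compact K" "V \<subseteq> K" for V K :: "'e set"
    using compact_Int_closed[OF that(1), of "closure V"] closure_minimal[OF that(2)] compact_imp_closed[OF that(1)]
    by (simp add: Int_absorb1)
  define \<V> where "\<V> = {V :: 'e set. open V \<and> compact (closure V)}"
  have "\<exists>V\<in>\<V>. x \<in> V" for x
  proof -
    have "\<exists>V K. open V \<and> compact K \<and> x \<in> V \<and> V \<subseteq> K"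
      using assms by (simp add: locally_compact_space_def)
    then obtain V K where "open V" "compact K" "x \<in> V" "V \<subseteq> K"
      by (elim exE conjE)
    then show ?thesis using compact_closure[of K V] by (intro bexI[of _ V]) (simp_all add: \<V>_def)
  qed
  then have cover: "\<Union>\<V> = UNIV" by blast
  obtain \<W> where \<W>: "\<W> \<subseteq> \<V>" "countable \<W>" "\<Union>\<W> = \<Union>\<V>"
    using Lindelof[of \<V>] unfolding \<V>_def by blast
  have "\<W> \<noteq> {}" using \<W> cover by auto
  define U where "U k = (\<Union>j\<le>k. from_nat_into \<W> j)" for k
  have W: "open (from_nat_into \<W> j)" "compact (closure (from_nat_into \<W> j))" for j
    using from_nat_into[OF \<open>\<W> \<noteq> {}\<close>, of j] \<W>(1) by (auto simp: \<V>_def)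
  show thesis
  proof
    show "incseq U" by (force simp: incseq_def U_def)
    have "(\<Union>k. U k) = (\<Union>j. from_nat_into \<W> j)" by (auto simp: U_def)
    then show "(\<Union>k. U k) = UNIV"
      using \<W> cover range_from_nat_into[OF \<open>\<W> \<noteq> {}\<close>] by auto
    show "U k \<in> bounded_borel" for k
    proof -
      have "compact (\<Union>j\<le>k. closure (from_nat_into \<W> j))"
        using W by (intro compact_UN) auto
      then have "compact (closure (U k))"
        by (rule compact_closure) (use closure_subset in \<open>auto simp: U_def\<close>)
      moreover have "open (U k)" unfolding U_def using W by auto
      ultimately show ?thesis by (simp add: bounded_borel_def)
    qed
  qed
qed

section \<open>Random measures on bounded sets\<close>

lemma radon_measureD:
  assumes "\<mu> \<in> radon_measures"
  shows "sets \<mu> = sets borel" and "B \<in> bounded_borel \<Longrightarrow> emeasure \<mu> B = ennreal (measure \<mu> B)"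
proof -
  show s: "sets \<mu> = sets borel" using assms by (simp add: radon_measures_def)
  assume B: "B \<in> bounded_borel"
  have "emeasure \<mu> B \<le> emeasure \<mu> (closure B)"
    by (intro emeasure_mono closure_subset) (simp add: s)
  also have "\<dots> < \<infinity>" using assms B unfolding radon_measures_def bounded_borel_def by blast
  finally show "emeasure \<mu> B = ennreal (measure \<mu> B)" by (simp add: emeasure_eq_ennreal_measure)
qed

lemma random_measure_measurable_measure:
  assumes "random_measure M \<Lambda>" "B \<in> bounded_borel"
  shows "(\<lambda>\<omega>. measure (\<Lambda> \<omega>) B) \<in> borel_measurable M"
proof -
  have "(\<lambda>\<mu>. emeasure \<mu> B) \<in> radon_space \<rightarrow>\<^sub>M borel"
    unfolding radon_space_def
    by (rule measurable_Sup1[OF imageI[OF assms(2)]]) (auto intro: measurable_vimage_algebra1)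
  then have "(\<lambda>\<omega>. emeasure (\<Lambda> \<omega>) B) \<in> borel_measurable M"
    using assms(1) unfolding random_measure_def by (rule measurable_compose[rotated])
  then show ?thesis unfolding measure_def by measurable
qed

lemma random_measure_radon: "random_measure M \<Lambda> \<Longrightarrow> \<omega> \<in> space M \<Longrightarrow> \<Lambda> \<omega> \<in> radon_measures"
  unfolding random_measure_def by (drule (1) measurable_space) (simp add: space_radon_space)

section \<open>Stability under nonnegative linear maps\<close>

text \<open>
  The linear map from \<open>\<real>\<^bsup>n k\<^esup>\<close> to \<open>\<real>\<^sup>n\<close> that forms the harmonic partial sum of each block of \<open>k\<close>
  consecutive coordinates.
\<close>

definition harmonic_block_sum :: "nat \<Rightarrow> nat \<Rightarrow> (nat \<Rightarrow> real) \<Rightarrow> nat \<Rightarrow> real" where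
  "harmonic_block_sum n k z = (\<lambda>i\<in>{..<n}. \<Sum>j<k. z (i * k + j) / real (Suc j))"

definition block_sum_closed :: "(nat \<Rightarrow> ((nat \<Rightarrow> real) \<Rightarrow> real) \<Rightarrow> bool) \<Rightarrow> bool" where
  "block_sum_closed \<FF> \<longleftrightarrow> (\<forall>n k f. \<FF> n f \<longrightarrow> \<FF> (n * k) (\<lambda>z. f (harmonic_block_sum n k z)))"

lemma block_index_less: "i < n \<Longrightarrow> j < k \<Longrightarrow> i * k + j < n * (k::nat)"
proof -
  assume "i < n" "j < k"
  then have "i * k + j < Suc i * k" by simp
  also have "\<dots> \<le> n * k" using \<open>i < n\<close> by (intro mult_le_mono1) simp
  finally show ?thesis .
qed

lemma harmonic_block_sum_in_Rn: "harmonic_block_sum n k z \<in> space (Rn n)"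
  unfolding harmonic_block_sum_def by (rule restrict_in_Rn)

lemma vle_harmonic_block_sum:
  "vle (n * k) x y \<Longrightarrow> vle n (harmonic_block_sum n k x) (harmonic_block_sum n k y)"
  unfolding vle_def harmonic_block_sum_def
proof (intro allI impI)
  fix i assume le: "\<forall>l<n * k. x l \<le> y l" and i: "i < n"
  have "(\<Sum>j<k. x (i * k + j) / real (Suc j)) \<le> (\<Sum>j<k. y (i * k + j) / real (Suc j))"
    using le block_index_less[OF i] by (intro sum_mono divide_right_mono) auto
  with i show "(\<lambda>i\<in>{..<n}. \<Sum>j<k. x (i * k + j) / real (Suc j)) i
      \<le> (\<lambda>i\<in>{..<n}. \<Sum>j<k. y (i * k + j) / real (Suc j)) i"
    by (simp only: restrict_apply' lessThan_iff)
qed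

lemma harmonic_block_sum_add:
  assumes "\<forall>l<n * k. x l + y l = p l + (q l :: real)"
  shows "\<forall>i<n. harmonic_block_sum n k x i + harmonic_block_sum n k y i
    = harmonic_block_sum n k p i + harmonic_block_sum n k q i"
proof (intro allI impI)
  fix i assume i: "i < n"
  have "x (i * k + j) / real (Suc j) + y (i * k + j) / real (Suc j)
      = p (i * k + j) / real (Suc j) + q (i * k + j) / real (Suc j)" if "j < k" for j
    using assms block_index_less[OF i that] by (metis add_divide_distrib)
  then have "(\<Sum>j<k. x (i * k + j) / real (Suc j) + y (i * k + j) / real (Suc j))
      = (\<Sum>j<k. p (i * k + j) / real (Suc j) + q (i * k + j) / real (Suc j))"
    by (intro sum.cong) (simp_all del: of_nat_Suc)
  then show "harmonic_block_sum n k x i + harmonic_block_sum n k y i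
      = harmonic_block_sum n k p i + harmonic_block_sum n k q i"
    using i by (simp add: harmonic_block_sum_def sum.distrib)
qed

lemma block_sum_closed_dcx: "block_sum_closed dcx"
  unfolding block_sum_closed_def dcx_def
proof (intro allI impI ballI, elim conjE)
  fix n k and f :: "(nat \<Rightarrow> real) \<Rightarrow> real" and x y p q :: "nat \<Rightarrow> real"
  let ?S = "harmonic_block_sum n k"
  assume *: "\<forall>x\<in>space (Rn n). \<forall>y\<in>space (Rn n). \<forall>p\<in>space (Rn n). \<forall>q\<in>space (Rn n).
      vle n p x \<and> vle n p y \<and> vle n x q \<and> vle n y q \<and> (\<forall>i<n. x i + y i = p i + q i)
      \<longrightarrow> f x + f y \<le> f p + f q"
  assume le: "vle (n * k) p x" "vle (n * k) p y" "vle (n * k) x q" "vle (n * k) y q"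
    and eq: "\<forall>i<n * k. x i + y i = p i + q i"
  show "f (?S x) + f (?S y) \<le> f (?S p) + f (?S q)"
    using *[rule_format, of "?S x" "?S y" "?S p" "?S q"] le[THEN vle_harmonic_block_sum]
      harmonic_block_sum_add[OF eq] by (simp add: harmonic_block_sum_in_Rn)
qed

lemma block_sum_closed_dcv: "block_sum_closed dcv"
  unfolding block_sum_closed_def dcv_def
proof (intro allI impI ballI, elim conjE)
  fix n k and f :: "(nat \<Rightarrow> real) \<Rightarrow> real" and x y p q :: "nat \<Rightarrow> real"
  let ?S = "harmonic_block_sum n k"
  assume *: "\<forall>x\<in>space (Rn n). \<forall>y\<in>space (Rn n). \<forall>p\<in>space (Rn n). \<forall>q\<in>space (Rn n).
      vle n p x \<and> vle n p y \<and> vle n x q \<and> vle n y q \<and> (\<forall>i<n. x i + y i = p i + q i)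
      \<longrightarrow> f p + f q \<le> f x + f y"
  assume le: "vle (n * k) p x" "vle (n * k) p y" "vle (n * k) x q" "vle (n * k) y q"
    and eq: "\<forall>i<n * k. x i + y i = p i + q i"
  show "f (?S p) + f (?S q) \<le> f (?S x) + f (?S y)"
    using *[rule_format, of "?S x" "?S y" "?S p" "?S q"] le[THEN vle_harmonic_block_sum]
      harmonic_block_sum_add[OF eq] by (simp add: harmonic_block_sum_in_Rn)
qed

lemma block_sum_closed_increasing: "block_sum_closed increasing_fun"
  unfolding block_sum_closed_def increasing_fun_def
proof (intro allI impI ballI)
  fix n k and f :: "(nat \<Rightarrow> real) \<Rightarrow> real" and x y :: "nat \<Rightarrow> real"
  assume "\<forall>x\<in>space (Rn n). \<forall>y\<in>space (Rn n). vle n x y \<longrightarrow> f x \<le> f y" "vle (n * k) x y"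
  then show "f (harmonic_block_sum n k x) \<le> f (harmonic_block_sum n k y)"
    using harmonic_block_sum_in_Rn vle_harmonic_block_sum by blast
qed

lemma block_sum_closed_conj:
  assumes F: "block_sum_closed F" and G: "block_sum_closed G"
  shows "block_sum_closed (\<lambda>n f. F n f \<and> G n f)"
  unfolding block_sum_closed_def
proof (intro allI impI)
  fix n k f assume "F n f \<and> G n f"
  then show "F (n * k) (\<lambda>z. f (harmonic_block_sum n k z)) \<and> G (n * k) (\<lambda>z. f (harmonic_block_sum n k z))"
    using F[unfolded block_sum_closed_def, THEN spec, of n, THEN spec, of k, THEN spec, of f]
      G[unfolded block_sum_closed_def, THEN spec, of n, THEN spec, of k, THEN spec, of f]
    by blast
qed

lemma block_sum_closed_idcx: "block_sum_closed idcx"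
  unfolding idcx_def[abs_def] by (intro block_sum_closed_conj block_sum_closed_increasing block_sum_closed_dcx)

lemma block_sum_closed_idcv: "block_sum_closed idcv"
  unfolding idcv_def[abs_def] by (intro block_sum_closed_conj block_sum_closed_increasing block_sum_closed_dcv)

lemma measurable_harmonic_block_sum: "harmonic_block_sum n k \<in> Rn (n * k) \<rightarrow>\<^sub>M Rn n"
  unfolding harmonic_block_sum_def[abs_def]
proof (rule measurable_restrict_Rn)
  fix i assume i: "i < n"
  have "(\<lambda>z. z (i * k + j)) \<in> borel_measurable (Rn (n * k))" if "j < k" for j
    unfolding Rn_def using block_index_less[OF i that] by (intro measurable_component_singleton) simp
  then show "(\<lambda>z. \<Sum>j<k. z (i * k + j) / real (Suc j)) \<in> borel_measurable (Rn (n * k))"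
    by (intro borel_measurable_sum borel_measurable_divide borel_measurable_const) auto
qed

section \<open>Approximation of the shot noise field\<close>

definition harmonic_mass :: "nat \<Rightarrow> (nat \<Rightarrow> nat \<Rightarrow> 'e set) \<Rightarrow> nat \<Rightarrow> 'e measure \<Rightarrow> nat \<Rightarrow> real" where
  "harmonic_mass n B k \<mu> = (\<lambda>i\<in>{..<n}. \<Sum>j<k. measure \<mu> (B i j) / real (Suc j))"

lemma harmonic_mass_in_Rn: "harmonic_mass n B k \<mu> \<in> space (Rn n)"
  unfolding harmonic_mass_def by (rule restrict_in_Rn)

lemma harmonic_mass_nonneg: "i < n \<Longrightarrow> 0 \<le> harmonic_mass n B k \<mu> i"
  by (simp add: harmonic_mass_def sum_nonneg)

lemma incseq_harmonic_mass: "i < n \<Longrightarrow> incseq (\<lambda>k. harmonic_mass n B k \<mu> i)"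
  by (simp add: harmonic_mass_def incseq_Suc_iff)

lemma measurable_harmonic_mass:
  assumes "random_measure M \<Lambda>" "\<And>i j. i < n \<Longrightarrow> B i j \<in> bounded_borel"
  shows "(\<lambda>\<omega>. harmonic_mass n B k (\<Lambda> \<omega>)) \<in> M \<rightarrow>\<^sub>M Rn n"
  unfolding harmonic_mass_def
  using assms by (intro measurable_restrict_Rn borel_measurable_sum borel_measurable_divide
      borel_measurable_const random_measure_measurable_measure)

lemma SUP_harmonic_mass:
  fixes h :: "'e::topological_space \<Rightarrow> ennreal"
  assumes \<mu>: "\<mu> \<in> radon_measures" and i: "i < n" and B: "\<And>j. B i j \<in> bounded_borel"
    and h: "\<And>x. (SUP k. \<Sum>j<k. ennreal (1 / real (Suc j)) * indicator (B i j) x) = h x"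
  shows "(SUP k. ennreal (harmonic_mass n B k \<mu> i)) = (\<integral>\<^sup>+x. h x \<partial>\<mu>)"
proof -
  let ?g = "\<lambda>k x. \<Sum>j<k. ennreal (1 / real (Suc j)) * indicator (B i j) x"
  have sets: "B i j \<in> sets \<mu>" for j
    using B[of j] radon_measureD(1)[OF \<mu>] by (simp add: bounded_borel_def)
  have "ennreal (harmonic_mass n B k \<mu> i) = (\<integral>\<^sup>+x. ?g k x \<partial>\<mu>)" for k
  proof -
    have "(\<integral>\<^sup>+x. ?g k x \<partial>\<mu>) = (\<Sum>j<k. ennreal (1 / real (Suc j)) * emeasure \<mu> (B i j))"
      using sets by (subst nn_integral_sum) (auto simp: nn_integral_cmult_indicator)
    also have "\<dots> = (\<Sum>j<k. ennreal (measure \<mu> (B i j) / real (Suc j)))"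
      by (simp add: radon_measureD(2)[OF \<mu> B] ennreal_mult[symmetric] del: of_nat_Suc)
    also have "\<dots> = ennreal (harmonic_mass n B k \<mu> i)"
      using i by (simp add: harmonic_mass_def)
    finally show ?thesis by (rule sym)
  qed
  then have "(SUP k. ennreal (harmonic_mass n B k \<mu> i)) = (SUP k. \<integral>\<^sup>+x. ?g k x \<partial>\<mu>)" by simp
  also have "\<dots> = (\<integral>\<^sup>+x. (SUP k. ?g k x) \<partial>\<mu>)"
  proof (rule nn_integral_monotone_convergence_SUP[symmetric])
    show "incseq ?g"
      by (intro incseq_SucI le_funI, simp only: sum.lessThan_Suc) (intro add_increasing2 order_refl zero_le)
    show "?g k \<in> borel_measurable \<mu>" for k
      by (intro borel_measurable_sum borel_measurable_times_ennreal borel_measurable_const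
          borel_measurable_indicator sets)
  qed
  finally show ?thesis by (simp only: h)
qed

lemma shot_noise_approximation:
  fixes h :: "'e::{second_countable_topology, t2_space} \<Rightarrow> 's \<Rightarrow> ennreal"
  assumes lc: "locally_compact_space (euclidean :: 'e topology)"
    and h: "\<And>i. i < n \<Longrightarrow> (\<lambda>x. h x (s i)) \<in> borel_measurable borel"
  obtains B :: "nat \<Rightarrow> nat \<Rightarrow> 'e set" where "\<And>i j. i < n \<Longrightarrow> B i j \<in> bounded_borel"
    "\<And>\<mu> i. \<mu> \<in> radon_measures \<Longrightarrow> i < n
      \<Longrightarrow> (SUP k. ennreal (harmonic_mass n B k \<mu> i)) = (\<integral>\<^sup>+x. h x (s i) \<partial>\<mu>)"
proof -
  obtain U :: "nat \<Rightarrow> 'e set" where U: "incseq U" "(\<Union>k. U k) = UNIV" "\<And>k. U k \<in> bounded_borel"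
    using bounded_borel_exhaustion[OF lc] by metis
  have "\<forall>i. \<exists>B. i < n \<longrightarrow> (\<forall>j. B j \<in> bounded_borel) \<and>
      (\<forall>x. (SUP k. \<Sum>j<k. ennreal (1 / real (Suc j)) * indicator (B j) x) = h x (s i))"
    using harmonic_indicator_series[OF h U] by blast
  then obtain B where B: "\<forall>i. i < n \<longrightarrow> (\<forall>j. B i j \<in> bounded_borel) \<and>
      (\<forall>x. (SUP k. \<Sum>j<k. ennreal (1 / real (Suc j)) * indicator (B i j) x) = h x (s i))"
    by (rule choice[THEN exE])
  show thesis
  proof (rule that[of B])
    show "B i j \<in> bounded_borel" if "i < n" for i j using B that by blast
    show "(SUP k. ennreal (harmonic_mass n B k \<mu> i)) = (\<integral>\<^sup>+x. h x (s i) \<partial>\<mu>)"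
      if "\<mu> \<in> radon_measures" "i < n" for \<mu> i
      using B that by (intro SUP_harmonic_mass) blast+
  qed
qed

text \<open>
  The test function is pulled back along the linear map that takes the \<open>n * k\<close> masses to the \<open>n\<close> partial
  sums; the order on random measures compares the vectors of masses.
\<close>

lemma rm_le_harmonic_mass:
  assumes closed: "block_sum_closed F" and le: "rm_le F M \<Lambda>\<^sub>1 N \<Lambda>\<^sub>2"
    and f: "F n f" "f \<in> borel_measurable (Rn n)"
    and nk: "1 \<le> n" "1 \<le> k" and B: "\<And>i j. i < n \<Longrightarrow> B i j \<in> bounded_borel"
    and int: "integrable M (\<lambda>\<omega>. f (harmonic_mass n B k (\<Lambda>\<^sub>1 \<omega>)))"
      "integrable N (\<lambda>\<omega>. f (harmonic_mass n B k (\<Lambda>\<^sub>2 \<omega>)))"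
  shows "(\<integral>\<omega>. f (harmonic_mass n B k (\<Lambda>\<^sub>1 \<omega>)) \<partial>M) \<le> (\<integral>\<omega>. f (harmonic_mass n B k (\<Lambda>\<^sub>2 \<omega>)) \<partial>N)"
proof -
  \<comment> \<open>The coordinate \<open>i * k + j\<close> carries the \<open>j\<close>-th set for the index \<open>i\<close>.\<close>
  define s where "s l = B (l div k) (l mod k)" for l
  have mass: "harmonic_block_sum n k (\<lambda>l\<in>{..<n * k}. measure \<mu> (s l)) = harmonic_mass n B k \<mu>" for \<mu>
  proof (rule Rn_ext[OF harmonic_block_sum_in_Rn harmonic_mass_in_Rn])
    fix i assume i: "i < n"
    have "s (i * k + j) = B i j" if "j < k" for j using that by (simp add: s_def)
    then show "harmonic_block_sum n k (\<lambda>l\<in>{..<n * k}. measure \<mu> (s l)) i = harmonic_mass n B k \<mu> i"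
      using i by (simp add: harmonic_block_sum_def harmonic_mass_def block_index_less)
  qed
  have "\<forall>l<n * k. s l \<in> bounded_borel"
    using B by (simp add: s_def less_mult_imp_div_less)
  moreover have "F (n * k) (\<lambda>z. f (harmonic_block_sum n k z))"
    using closed f(1) unfolding block_sum_closed_def by blast
  moreover have "(\<lambda>z. f (harmonic_block_sum n k z)) \<in> borel_measurable (Rn (n * k))"
    by (rule measurable_compose[OF measurable_harmonic_block_sum f(2)])
  moreover have "1 \<le> n * k" using nk by simp
  ultimately show ?thesis
    using le[unfolded rm_le_def field_le_def, rule_format, of "n * k" s "\<lambda>z. f (harmonic_block_sum n k z)"] int
    unfolding mass by blast
qed

section \<open>Passage to the limit\<close>

text \<open>
  The common limit argument for the three classes: what remains for each of them is to find the majorants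
  and to identify the limits.
\<close>

lemma rm_le_limit:
  assumes closed: "block_sum_closed F" and le: "rm_le F M \<Lambda>\<^sub>1 N \<Lambda>\<^sub>2"
    and \<Lambda>: "random_measure M \<Lambda>\<^sub>1" "random_measure N \<Lambda>\<^sub>2"
    and f: "F n f" "f \<in> borel_measurable (Rn n)"
    and n: "1 \<le> n" and B: "\<And>i j. i < n \<Longrightarrow> B i j \<in> bounded_borel"
    and Z: "Z\<^sub>1 \<in> borel_measurable M" "Z\<^sub>2 \<in> borel_measurable N"
    and W: "integrable M W\<^sub>1" "integrable N W\<^sub>2"
    and lim: "AE \<omega> in M. (\<lambda>k. f (harmonic_mass n B k (\<Lambda>\<^sub>1 \<omega>))) \<longlonglongrightarrow> Z\<^sub>1 \<omega>"
      "AE \<omega> in N. (\<lambda>k. f (harmonic_mass n B k (\<Lambda>\<^sub>2 \<omega>))) \<longlonglongrightarrow> Z\<^sub>2 \<omega>"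
    and dom: "\<And>k. AE \<omega> in M. \<bar>f (harmonic_mass n B k (\<Lambda>\<^sub>1 \<omega>))\<bar> \<le> W\<^sub>1 \<omega>"
      "\<And>k. AE \<omega> in N. \<bar>f (harmonic_mass n B k (\<Lambda>\<^sub>2 \<omega>))\<bar> \<le> W\<^sub>2 \<omega>"
  shows "(\<integral>\<omega>. Z\<^sub>1 \<omega> \<partial>M) \<le> (\<integral>\<omega>. Z\<^sub>2 \<omega> \<partial>N)"
proof -
  have meas: "(\<lambda>\<omega>. f (harmonic_mass n B k (\<Lambda>\<^sub>1 \<omega>))) \<in> borel_measurable M"
    "(\<lambda>\<omega>. f (harmonic_mass n B k (\<Lambda>\<^sub>2 \<omega>))) \<in> borel_measurable N" for k
    using measurable_harmonic_mass[where B = B, OF \<Lambda>(1) B] measurable_harmonic_mass[where B = B, OF \<Lambda>(2) B]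
    by (auto intro: measurable_compose[OF _ f(2)])
  have norm: "\<And>k. AE \<omega> in M. norm (f (harmonic_mass n B k (\<Lambda>\<^sub>1 \<omega>))) \<le> W\<^sub>1 \<omega>"
      "\<And>k. AE \<omega> in N. norm (f (harmonic_mass n B k (\<Lambda>\<^sub>2 \<omega>))) \<le> W\<^sub>2 \<omega>"
    using dom by simp_all
  note dc\<^sub>1 = Z(1) meas(1) W(1) lim(1) norm(1)
  note dc\<^sub>2 = Z(2) meas(2) W(2) lim(2) norm(2)
  show ?thesis
  proof (rule LIMSEQ_le)
    show "(\<lambda>k. \<integral>\<omega>. f (harmonic_mass n B k (\<Lambda>\<^sub>1 \<omega>)) \<partial>M) \<longlonglongrightarrow> (\<integral>\<omega>. Z\<^sub>1 \<omega> \<partial>M)"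
      by (rule integral_dominated_convergence[OF dc\<^sub>1])
    show "(\<lambda>k. \<integral>\<omega>. f (harmonic_mass n B k (\<Lambda>\<^sub>2 \<omega>)) \<partial>N) \<longlonglongrightarrow> (\<integral>\<omega>. Z\<^sub>2 \<omega> \<partial>N)"
      by (rule integral_dominated_convergence[OF dc\<^sub>2])
    show "\<exists>K. \<forall>k\<ge>K. (\<integral>\<omega>. f (harmonic_mass n B k (\<Lambda>\<^sub>1 \<omega>)) \<partial>M)
        \<le> (\<integral>\<omega>. f (harmonic_mass n B k (\<Lambda>\<^sub>2 \<omega>)) \<partial>N)"
      using rm_le_harmonic_mass[where B = B, OF closed le f n _ B]
        integrable_dominated_convergence2[OF dc\<^sub>1] integrable_dominated_convergence2[OF dc\<^sub>2]
      by (intro exI[of _ 1] allI impI) blast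
  qed
qed

lemma increasing_limit_and_bound:
  assumes incr: "increasing_fun n f"
    and sect: "\<And>x i. x \<in> space (Rn n) \<Longrightarrow> i < n \<Longrightarrow> isCont (\<lambda>t. f (x(i := t))) (x i)"
    and V: "\<And>i. i < n \<Longrightarrow> (SUP k. ennreal (harmonic_mass n B k \<mu> i)) = V i"
    and fin: "\<bar>ext_mono n f V\<bar> \<noteq> \<infinity>"
  shows "(\<lambda>k. f (harmonic_mass n B k \<mu>)) \<longlonglongrightarrow> real_of_ereal (ext_mono n f V)"
    and "\<bar>f (harmonic_mass n B k \<mu>)\<bar> \<le> \<bar>f (\<lambda>i\<in>{..<n}. 0)\<bar> + \<bar>real_of_ereal (ext_mono n f V)\<bar>"
proof -
  note ext = incseq_LIMSEQ_ext_mono[where v = "\<lambda>k. harmonic_mass n B k \<mu>",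
      OF incr sect harmonic_mass_in_Rn harmonic_mass_nonneg incseq_harmonic_mass V]
  obtain r where r: "ext_mono n f V = ereal r" using fin by auto
  show "(\<lambda>k. f (harmonic_mass n B k \<mu>)) \<longlonglongrightarrow> real_of_ereal (ext_mono n f V)"
    using ext(2) by (simp add: r)
  have "f (harmonic_mass n B k \<mu>) \<le> r" using ext(1)[of k] by (simp add: r)
  moreover have "f (\<lambda>i\<in>{..<n}. 0) \<le> f (harmonic_mass n B k \<mu>)"
    by (intro increasing_funD[OF incr] restrict_in_Rn harmonic_mass_in_Rn) (simp add: harmonic_mass_nonneg)
  ultimately show "\<bar>f (harmonic_mass n B k \<mu>)\<bar> \<le> \<bar>f (\<lambda>i\<in>{..<n}. 0)\<bar> + \<bar>real_of_ereal (ext_mono n f V)\<bar>"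
    by (simp add: r)
qed

lemma AE_increasing_limit_and_bound:
  assumes \<Lambda>: "random_measure M \<Lambda>"
    and incr: "increasing_fun n f"
    and sect: "\<And>x i. x \<in> space (Rn n) \<Longrightarrow> i < n \<Longrightarrow> isCont (\<lambda>t. f (x(i := t))) (x i)"
    and approx: "\<And>\<mu> i. \<mu> \<in> radon_measures \<Longrightarrow> i < n
      \<Longrightarrow> (SUP k. ennreal (harmonic_mass n B k \<mu> i)) = (\<integral>\<^sup>+x. h x (s i) \<partial>\<mu>)"
    and fin: "finite_expectation M (\<lambda>\<omega>. ext_mono n f (\<lambda>i. shot_noise h \<Lambda> \<omega> (s i)))"
  defines "Z \<equiv> \<lambda>\<omega>. real_of_ereal (ext_mono n f (\<lambda>i. shot_noise h \<Lambda> \<omega> (s i)))"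
  shows "AE \<omega> in M. (\<lambda>k. f (harmonic_mass n B k (\<Lambda> \<omega>))) \<longlonglongrightarrow> Z \<omega> \<and>
    (\<forall>k. \<bar>f (harmonic_mass n B k (\<Lambda> \<omega>))\<bar> \<le> \<bar>f (\<lambda>i\<in>{..<n}. 0)\<bar> + \<bar>Z \<omega>\<bar>)"
proof -
  have "AE \<omega> in M. \<bar>ext_mono n f (\<lambda>i. shot_noise h \<Lambda> \<omega> (s i))\<bar> \<noteq> \<infinity>"
    using fin unfolding finite_expectation_def by blast
  with AE_space[of M] show ?thesis
  proof eventually_elim
    case (elim \<omega>)
    have V: "(SUP k. ennreal (harmonic_mass n B k (\<Lambda> \<omega>) i)) = shot_noise h \<Lambda> \<omega> (s i)" if "i < n" for i
      using approx[OF random_measure_radon[OF \<Lambda> elim(1)] that] by (simp add: shot_noise_def)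
    show ?case
      using increasing_limit_and_bound[OF incr sect V elim(2)] unfolding Z_def by blast
  qed
qed

text \<open>
  For increasing classes the two ends \<open>f(0)\<close> and \<open>f(V)\<close> already majorize the approximations.
\<close>

lemma ext_field_le_shot_noise:
  fixes h :: "'e::{second_countable_topology, t2_space} \<Rightarrow> 's \<Rightarrow> ennreal"
  assumes lc: "locally_compact_space (euclidean :: 'e topology)"
    and h: "\<And>y. y \<in> S \<Longrightarrow> (\<lambda>x. h x y) \<in> borel_measurable borel"
    and prob: "prob_space M" "prob_space N"
    and \<Lambda>: "random_measure M \<Lambda>\<^sub>1" "random_measure N \<Lambda>\<^sub>2"
    and closed: "block_sum_closed F" and incr: "\<And>n f. F n f \<Longrightarrow> increasing_fun n f"
    and sect: "\<And>n f x i a. F n f \<Longrightarrow> f \<in> borel_measurable (Rn n) \<Longrightarrow> x \<in> space (Rn n) \<Longrightarrow> i < n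
      \<Longrightarrow> isCont (\<lambda>t. f (x(i := t))) a"
    and le: "rm_le F M \<Lambda>\<^sub>1 N \<Lambda>\<^sub>2"
  shows "ext_field_le F S M (shot_noise h \<Lambda>\<^sub>1) N (shot_noise h \<Lambda>\<^sub>2)"
  unfolding ext_field_le_def
proof (intro allI impI, elim conjE)
  interpret M: prob_space M by fact
  interpret N: prob_space N by fact
  fix n :: nat and s f
  assume n: "1 \<le> n" and s: "\<forall>i<n. s i \<in> S" and f: "F n f" "f \<in> borel_measurable (Rn n)"
  assume fin: "finite_expectation M (\<lambda>\<omega>. ext_mono n f (\<lambda>i. shot_noise h \<Lambda>\<^sub>1 \<omega> (s i)))"
    "finite_expectation N (\<lambda>\<omega>. ext_mono n f (\<lambda>i. shot_noise h \<Lambda>\<^sub>2 \<omega> (s i)))"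
  have hs: "(\<lambda>x. h x (s i)) \<in> borel_measurable borel" if "i < n" for i
    using h s that by blast
  obtain B where B: "\<And>i j. i < n \<Longrightarrow> B i j \<in> bounded_borel"
    and approx: "\<And>\<mu> i. \<mu> \<in> radon_measures \<Longrightarrow> i < n
      \<Longrightarrow> (SUP k. ennreal (harmonic_mass n B k \<mu> i)) = (\<integral>\<^sup>+x. h x (s i) \<partial>\<mu>)"
    using shot_noise_approximation[where h = h and s = s and n = n, OF lc hs] by metis
  define Z\<^sub>1 where "Z\<^sub>1 \<omega> = real_of_ereal (ext_mono n f (\<lambda>i. shot_noise h \<Lambda>\<^sub>1 \<omega> (s i)))" for \<omega>
  define Z\<^sub>2 where "Z\<^sub>2 \<omega> = real_of_ereal (ext_mono n f (\<lambda>i. shot_noise h \<Lambda>\<^sub>2 \<omega> (s i)))" for \<omega>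
  have int: "integrable M Z\<^sub>1" "integrable N Z\<^sub>2"
    using fin by (simp_all add: finite_expectation_def Z\<^sub>1_def[abs_def] Z\<^sub>2_def[abs_def])
  let ?c = "\<bar>f (\<lambda>i\<in>{..<n}. 0)\<bar>"
  have ae\<^sub>1: "AE \<omega> in M. (\<lambda>k. f (harmonic_mass n B k (\<Lambda>\<^sub>1 \<omega>))) \<longlonglongrightarrow> Z\<^sub>1 \<omega> \<and>
      (\<forall>k. \<bar>f (harmonic_mass n B k (\<Lambda>\<^sub>1 \<omega>))\<bar> \<le> ?c + \<bar>Z\<^sub>1 \<omega>\<bar>)"
    unfolding Z\<^sub>1_def
    by (rule AE_increasing_limit_and_bound[where B = B and s = s and h = h,
          OF \<Lambda>(1) incr[OF f(1)] sect[OF f] approx fin(1)])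
  have ae\<^sub>2: "AE \<omega> in N. (\<lambda>k. f (harmonic_mass n B k (\<Lambda>\<^sub>2 \<omega>))) \<longlonglongrightarrow> Z\<^sub>2 \<omega> \<and>
      (\<forall>k. \<bar>f (harmonic_mass n B k (\<Lambda>\<^sub>2 \<omega>))\<bar> \<le> ?c + \<bar>Z\<^sub>2 \<omega>\<bar>)"
    unfolding Z\<^sub>2_def
    by (rule AE_increasing_limit_and_bound[where B = B and s = s and h = h,
          OF \<Lambda>(2) incr[OF f(1)] sect[OF f] approx fin(2)])
  have "(\<integral>\<omega>. Z\<^sub>1 \<omega> \<partial>M) \<le> (\<integral>\<omega>. Z\<^sub>2 \<omega> \<partial>N)"
  proof (rule rm_le_limit[where B = B, OF closed le \<Lambda> f n B])
    show "integrable M (\<lambda>\<omega>. ?c + \<bar>Z\<^sub>1 \<omega>\<bar>)" "integrable N (\<lambda>\<omega>. ?c + \<bar>Z\<^sub>2 \<omega>\<bar>)"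
      using int by simp_all
  qed (use int ae\<^sub>1 ae\<^sub>2 in auto)
  then show "(\<integral>\<omega>. real_of_ereal (ext_mono n f (\<lambda>i. shot_noise h \<Lambda>\<^sub>1 \<omega> (s i))) \<partial>M)
      \<le> (\<integral>\<omega>. real_of_ereal (ext_mono n f (\<lambda>i. shot_noise h \<Lambda>\<^sub>2 \<omega> (s i))) \<partial>N)"
    by (simp only: Z\<^sub>1_def Z\<^sub>2_def)
qed

lemma shot_noise_measurable:
  assumes \<Lambda>: "random_measure M \<Lambda>" and B: "\<And>i j. i < n \<Longrightarrow> B i j \<in> bounded_borel"
    and approx: "\<And>\<mu> i. \<mu> \<in> radon_measures \<Longrightarrow> i < n
      \<Longrightarrow> (SUP k. ennreal (harmonic_mass n B k \<mu> i)) = (\<integral>\<^sup>+x. h x (s i) \<partial>\<mu>)"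
    and i: "i < n"
  shows "(\<lambda>\<omega>. shot_noise h \<Lambda> \<omega> (s i)) \<in> borel_measurable M"
proof -
  have "(\<lambda>x. x i) \<in> borel_measurable (Rn n)"
    unfolding Rn_def using i by (intro measurable_component_singleton) simp
  with measurable_harmonic_mass[where B = B and n = n, OF \<Lambda> B]
  have "(\<lambda>\<omega>. harmonic_mass n B k (\<Lambda> \<omega>) i) \<in> borel_measurable M" for k
    by (rule measurable_compose)
  then have "(\<lambda>\<omega>. SUP k. ennreal (harmonic_mass n B k (\<Lambda> \<omega>) i)) \<in> borel_measurable M"
    by measurable
  moreover have "(SUP k. ennreal (harmonic_mass n B k (\<Lambda> \<omega>) i)) = shot_noise h \<Lambda> \<omega> (s i)"
    if "\<omega> \<in> space M" for \<omega>
    using approx[OF random_measure_radon[OF \<Lambda> that] i] by (simp add: shot_noise_def)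
  ultimately show ?thesis by (simp cong: measurable_cong)
qed

lemma ext_mono_cong: "(\<And>i. i < n \<Longrightarrow> V i = V' i) \<Longrightarrow> ext_mono n f V = ext_mono n f V'"
  unfolding ext_mono_def by (intro SUP_cong arg_cong[of _ _ ereal] arg_cong[of _ _ f] restrict_cong) auto

text \<open>
  On the orthant \<open>f\<close> is an increasing function \<open>g\<close> minus a linear one.  Both parts converge, and both are
  bounded uniformly in \<open>k\<close>, \<open>g\<close> by its values at the two ends.  The factor \<open>2\<close> arises because the linear
  function enters twice, in \<open>f = g - \<dots>\<close> at the approximation and in \<open>g = f + \<dots>\<close> at the limit.
\<close>

lemma dcx_limit_and_bound:
  assumes f: "dcx n f" "f \<in> borel_measurable (Rn n)"
    and c: "increasing_fun n (\<lambda>x. f (pos_part n x) + (\<Sum>i<n. c i * max 0 (x i)))"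
    and V: "\<And>i. i < n \<Longrightarrow> (SUP k. ennreal (harmonic_mass n B k \<mu> i)) = V i"
    and fin: "\<And>i. i < n \<Longrightarrow> V i < \<infinity>"
  shows "(\<lambda>k. f (harmonic_mass n B k \<mu>)) \<longlonglongrightarrow> f (\<lambda>i\<in>{..<n}. enn2real (V i))" (is "_ \<longlonglongrightarrow> f ?x")
    and "\<bar>f (harmonic_mass n B k \<mu>)\<bar> \<le> \<bar>f (\<lambda>i\<in>{..<n}. 0)\<bar> + \<bar>f (\<lambda>i\<in>{..<n}. enn2real (V i))\<bar>
      + 2 * (\<Sum>i<n. \<bar>c i\<bar> * enn2real (V i))"
proof -
  define g where "g x = f (pos_part n x) + (\<Sum>i<n. c i * max 0 (x i))" for x
  let ?v = "\<lambda>k. harmonic_mass n B k \<mu>"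
  have g_incr: "increasing_fun n g" using c by (simp add: g_def[abs_def])
  have g_sect: "isCont (\<lambda>t. g (x(i := t))) a" if "x \<in> space (Rn n)" "i < n" for x i a
    unfolding g_def using that by (intro pos_part_plus_linear_section_continuous dcx_section_continuous[OF f])
  have g_eq: "g x = f x + (\<Sum>i<n. c i * x i)"
    if "x \<in> space (Rn n)" "\<And>i. i < n \<Longrightarrow> 0 \<le> x i" for x
  proof -
    have "pos_part n x = x"
    proof (rule Rn_ext)
      show "pos_part n x \<in> space (Rn n)" unfolding pos_part_def by (rule restrict_in_Rn)
      show "pos_part n x i = x i" if "i < n" for i
        using \<open>\<And>i. i < n \<Longrightarrow> 0 \<le> x i\<close>[OF that] that by (simp add: pos_part_def)
    qed fact
    then show ?thesis using that(2) by (simp add: g_def)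
  qed
  have x: "?x \<in> space (Rn n)" by (rule restrict_in_Rn)
  have V_eq: "V i = ennreal (?x i)" if "i < n" for i using that fin by simp
  have ext: "ext_mono n g V = ereal (g ?x)"
  proof -
    have "ext_mono n g V = ext_mono n g (\<lambda>i. ennreal (?x i))" by (rule ext_mono_cong[OF V_eq])
    also have "\<dots> = ereal (g ?x)" by (intro ext_mono_finite[OF g_incr x]) simp
    finally show ?thesis .
  qed
  note g_approx = increasing_limit_and_bound[OF g_incr g_sect V, unfolded ext real_of_ereal.simps]
  have g_lim: "(\<lambda>k. g (?v k)) \<longlonglongrightarrow> g ?x"
    by (rule g_approx(1)) simp_all
  have g_bound: "\<bar>g (?v k)\<bar> \<le> \<bar>g (\<lambda>i\<in>{..<n}. 0)\<bar> + \<bar>g ?x\<bar>" for k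
    by (rule g_approx(2)) simp_all
  have v_le: "?v k i \<le> ?x i" if "i < n" for k i
  proof -
    have "ennreal (?v k i) \<le> V i" unfolding V[OF that, symmetric] by (rule SUP_upper) simp
    also have "\<dots> = ennreal (?x i)" by (rule V_eq[OF that])
    finally show ?thesis using that by (simp add: ennreal_le_iff)
  qed
  have v_lim: "(\<lambda>k. ?v k i) \<longlonglongrightarrow> ?x i" if i: "i < n" for i
  proof (rule tendsto_ennrealD)
    have "incseq (\<lambda>k. ennreal (?v k i))"
      by (rule monoI) (intro ennreal_leI incseqD[OF incseq_harmonic_mass[OF i]])
    then show "(\<lambda>k. ennreal (?v k i)) \<longlonglongrightarrow> ennreal (?x i)"
      using LIMSEQ_SUP V[OF i] V_eq[OF i] by metis
  qed (use i in \<open>auto simp: harmonic_mass_nonneg\<close>)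
  have f_v: "f (?v k) = g (?v k) - (\<Sum>i<n. c i * ?v k i)" for k
    by (simp add: g_eq[OF harmonic_mass_in_Rn harmonic_mass_nonneg])
  have g_x: "g ?x = f ?x + (\<Sum>i<n. c i * ?x i)" by (intro g_eq[OF x]) simp
  have "(\<lambda>k. g (?v k) - (\<Sum>i<n. c i * ?v k i)) \<longlonglongrightarrow> g ?x - (\<Sum>i<n. c i * ?x i)"
    using v_lim by (intro tendsto_diff g_lim tendsto_sum tendsto_mult tendsto_const) auto
  then show "(\<lambda>k. f (?v k)) \<longlonglongrightarrow> f ?x" by (simp only: f_v[symmetric] g_x add_diff_cancel)
  have lin: "\<bar>\<Sum>i<n. c i * y i\<bar> \<le> (\<Sum>i<n. \<bar>c i\<bar> * ?x i)"
    if "\<And>i. i < n \<Longrightarrow> 0 \<le> y i" "\<And>i. i < n \<Longrightarrow> y i \<le> ?x i" for y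
  proof -
    have "\<bar>\<Sum>i<n. c i * y i\<bar> \<le> (\<Sum>i<n. \<bar>c i * y i\<bar>)" by (rule sum_abs)
    also have "\<dots> \<le> (\<Sum>i<n. \<bar>c i\<bar> * ?x i)"
    proof (rule sum_mono)
      fix i assume "i \<in> {..<n}"
      then show "\<bar>c i * y i\<bar> \<le> \<bar>c i\<bar> * ?x i"
        using that[of i] by (simp add: abs_mult mult_left_mono)
    qed
    finally show ?thesis .
  qed
  have "g (\<lambda>i\<in>{..<n}. 0) = f (\<lambda>i\<in>{..<n}. 0)" by (subst g_eq) (simp_all add: restrict_in_Rn)
  moreover have "\<bar>\<Sum>i<n. c i * ?x i\<bar> \<le> (\<Sum>i<n. \<bar>c i\<bar> * ?x i)"
    by (rule lin) simp_all
  moreover have "\<bar>\<Sum>i<n. c i * ?v k i\<bar> \<le> (\<Sum>i<n. \<bar>c i\<bar> * ?x i)"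
    by (rule lin[OF harmonic_mass_nonneg v_le])
  ultimately have "\<bar>f (?v k)\<bar> \<le> \<bar>f (\<lambda>i\<in>{..<n}. 0)\<bar> + \<bar>f ?x\<bar> + 2 * (\<Sum>i<n. \<bar>c i\<bar> * ?x i)"
    using g_bound[of k] unfolding f_v[of k] g_x by (simp only: abs_le_iff) linarith
  also have "(\<Sum>i<n. \<bar>c i\<bar> * ?x i) = (\<Sum>i<n. \<bar>c i\<bar> * enn2real (V i))" by simp
  finally show "\<bar>f (?v k)\<bar> \<le> \<bar>f (\<lambda>i\<in>{..<n}. 0)\<bar> + \<bar>f ?x\<bar> + 2 * (\<Sum>i<n. \<bar>c i\<bar> * enn2real (V i))" .
qed

lemma AE_dcx_limit_and_bound:
  assumes prob: "prob_space M" and \<Lambda>: "random_measure M \<Lambda>"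
    and f: "dcx n f" "f \<in> borel_measurable (Rn n)"
    and c: "increasing_fun n (\<lambda>x. f (pos_part n x) + (\<Sum>i<n. c i * max 0 (x i)))"
    and B: "\<And>i j. i < n \<Longrightarrow> B i j \<in> bounded_borel"
    and approx: "\<And>\<mu> i. \<mu> \<in> radon_measures \<Longrightarrow> i < n
      \<Longrightarrow> (SUP k. ennreal (harmonic_mass n B k \<mu> i)) = (\<integral>\<^sup>+x. h x (s i) \<partial>\<mu>)"
    and fin: "\<And>i. i < n \<Longrightarrow> (\<integral>\<^sup>+\<omega>. shot_noise h \<Lambda> \<omega> (s i) \<partial>M) < \<infinity>"
    and int: "integrable M (\<lambda>\<omega>. f (\<lambda>i\<in>{..<n}. enn2real (shot_noise h \<Lambda> \<omega> (s i))))"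
  obtains W where "integrable M W"
    "AE \<omega> in M. (\<lambda>k. f (harmonic_mass n B k (\<Lambda> \<omega>)))
        \<longlonglongrightarrow> f (\<lambda>i\<in>{..<n}. enn2real (shot_noise h \<Lambda> \<omega> (s i)))
      \<and> (\<forall>k. \<bar>f (harmonic_mass n B k (\<Lambda> \<omega>))\<bar> \<le> W \<omega>)"
proof -
  interpret prob_space M by fact
  define W where "W \<omega> = \<bar>f (\<lambda>i\<in>{..<n}. 0)\<bar> + \<bar>f (\<lambda>i\<in>{..<n}. enn2real (shot_noise h \<Lambda> \<omega> (s i)))\<bar>
    + 2 * (\<Sum>i<n. \<bar>c i\<bar> * enn2real (shot_noise h \<Lambda> \<omega> (s i)))" for \<omega>
  have meas: "(\<lambda>\<omega>. shot_noise h \<Lambda> \<omega> (s i)) \<in> borel_measurable M" if "i < n" for i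
    by (rule shot_noise_measurable[where B = B and n = n and s = s and h = h, OF \<Lambda> B approx that])
  have int_V: "integrable M (\<lambda>\<omega>. enn2real (shot_noise h \<Lambda> \<omega> (s i)))" if "i < n" for i
  proof (rule integrableI_nonneg)
    have "(\<integral>\<^sup>+\<omega>. ennreal (enn2real (shot_noise h \<Lambda> \<omega> (s i))) \<partial>M) \<le> (\<integral>\<^sup>+\<omega>. shot_noise h \<Lambda> \<omega> (s i) \<partial>M)"
      by (intro nn_integral_mono) (simp add: ennreal_enn2real_if)
    then show "(\<integral>\<^sup>+\<omega>. ennreal (enn2real (shot_noise h \<Lambda> \<omega> (s i))) \<partial>M) < \<infinity>"
      using fin[OF that] by simp
  qed (use meas[OF that] in auto)
  have "integrable M W"
    unfolding W_def using int int_V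
    by (intro Bochner_Integration.integrable_add integrable_mult_right Bochner_Integration.integrable_sum
        integrable_abs integrable_const) auto
  moreover have "AE \<omega> in M. \<forall>i\<in>{..<n}. shot_noise h \<Lambda> \<omega> (s i) < \<infinity>"
  proof (intro AE_finite_allI)
    fix i assume "i \<in> {..<n}"
    then show "AE \<omega> in M. shot_noise h \<Lambda> \<omega> (s i) < \<infinity>"
      using nn_integral_PInf_AE[OF meas, of i] fin[of i] by (auto simp: less_top[symmetric])
  qed simp
  with AE_space have "AE \<omega> in M. (\<lambda>k. f (harmonic_mass n B k (\<Lambda> \<omega>)))
      \<longlonglongrightarrow> f (\<lambda>i\<in>{..<n}. enn2real (shot_noise h \<Lambda> \<omega> (s i))) \<and>
      (\<forall>k. \<bar>f (harmonic_mass n B k (\<Lambda> \<omega>))\<bar> \<le> W \<omega>)"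
  proof eventually_elim
    case (elim \<omega>)
    have V: "(SUP k. ennreal (harmonic_mass n B k (\<Lambda> \<omega>) i)) = shot_noise h \<Lambda> \<omega> (s i)" if "i < n" for i
      using approx[OF random_measure_radon[OF \<Lambda> elim(1)] that] by (simp add: shot_noise_def)
    have "shot_noise h \<Lambda> \<omega> (s i) < \<infinity>" if "i < n" for i using elim(2) that by blast
    from dcx_limit_and_bound[OF f c V this] show ?case unfolding W_def by blast
  qed
  ultimately show thesis by (rule that)
qed

lemma field_le_dcx_shot_noise:
  fixes h :: "'e::{second_countable_topology, t2_space} \<Rightarrow> 's \<Rightarrow> ennreal"
  assumes lc: "locally_compact_space (euclidean :: 'e topology)"
    and h: "\<And>y. y \<in> S \<Longrightarrow> (\<lambda>x. h x y) \<in> borel_measurable borel"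
    and prob: "prob_space M" "prob_space N"
    and \<Lambda>: "random_measure M \<Lambda>\<^sub>1" "random_measure N \<Lambda>\<^sub>2"
    and mean: "\<forall>y\<in>S. (\<integral>\<^sup>+\<omega>. shot_noise h \<Lambda>\<^sub>1 \<omega> y \<partial>M) < \<infinity> \<and> (\<integral>\<^sup>+\<omega>. shot_noise h \<Lambda>\<^sub>2 \<omega> y \<partial>N) < \<infinity>"
    and le: "rm_le dcx M \<Lambda>\<^sub>1 N \<Lambda>\<^sub>2"
  shows "field_le dcx S M (\<lambda>\<omega> y. enn2real (shot_noise h \<Lambda>\<^sub>1 \<omega> y)) N (\<lambda>\<omega> y. enn2real (shot_noise h \<Lambda>\<^sub>2 \<omega> y))"
  unfolding field_le_def
proof (intro allI impI, elim conjE)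
  fix n :: nat and s f
  assume n: "1 \<le> n" and s: "\<forall>i<n. s i \<in> S" and f: "dcx n f" "f \<in> borel_measurable (Rn n)"
  assume int: "integrable M (\<lambda>\<omega>. f (\<lambda>i\<in>{..<n}. enn2real (shot_noise h \<Lambda>\<^sub>1 \<omega> (s i))))"
    "integrable N (\<lambda>\<omega>. f (\<lambda>i\<in>{..<n}. enn2real (shot_noise h \<Lambda>\<^sub>2 \<omega> (s i))))"
  have hs: "(\<lambda>x. h x (s i)) \<in> borel_measurable borel"
    and fin: "(\<integral>\<^sup>+\<omega>. shot_noise h \<Lambda>\<^sub>1 \<omega> (s i) \<partial>M) < \<infinity>" "(\<integral>\<^sup>+\<omega>. shot_noise h \<Lambda>\<^sub>2 \<omega> (s i) \<partial>N) < \<infinity>"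
    if "i < n" for i
    using h mean s that by blast+
  obtain B where B: "\<And>i j. i < n \<Longrightarrow> B i j \<in> bounded_borel"
    and approx: "\<And>\<mu> i. \<mu> \<in> radon_measures \<Longrightarrow> i < n
      \<Longrightarrow> (SUP k. ennreal (harmonic_mass n B k \<mu> i)) = (\<integral>\<^sup>+x. h x (s i) \<partial>\<mu>)"
    using shot_noise_approximation[where h = h and s = s and n = n, OF lc hs] by metis
  obtain c where c: "increasing_fun n (\<lambda>x. f (pos_part n x) + (\<Sum>i<n. c i * max 0 (x i)))"
    using dcx_plus_linear_increasing[OF f] .
  obtain W\<^sub>1 where W\<^sub>1: "integrable M W\<^sub>1"
    "AE \<omega> in M. (\<lambda>k. f (harmonic_mass n B k (\<Lambda>\<^sub>1 \<omega>)))
        \<longlonglongrightarrow> f (\<lambda>i\<in>{..<n}. enn2real (shot_noise h \<Lambda>\<^sub>1 \<omega> (s i)))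
      \<and> (\<forall>k. \<bar>f (harmonic_mass n B k (\<Lambda>\<^sub>1 \<omega>))\<bar> \<le> W\<^sub>1 \<omega>)"
    by (rule AE_dcx_limit_and_bound[where B = B and s = s and h = h, OF prob(1) \<Lambda>(1) f c B approx fin(1) int(1)])
      (assumption | rule that)+
  obtain W\<^sub>2 where W\<^sub>2: "integrable N W\<^sub>2"
    "AE \<omega> in N. (\<lambda>k. f (harmonic_mass n B k (\<Lambda>\<^sub>2 \<omega>)))
        \<longlonglongrightarrow> f (\<lambda>i\<in>{..<n}. enn2real (shot_noise h \<Lambda>\<^sub>2 \<omega> (s i)))
      \<and> (\<forall>k. \<bar>f (harmonic_mass n B k (\<Lambda>\<^sub>2 \<omega>))\<bar> \<le> W\<^sub>2 \<omega>)"
    by (rule AE_dcx_limit_and_bound[where B = B and s = s and h = h, OF prob(2) \<Lambda>(2) f c B approx fin(2) int(2)])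
      (assumption | rule that)+
  show "(\<integral>\<omega>. f (\<lambda>i\<in>{..<n}. enn2real (shot_noise h \<Lambda>\<^sub>1 \<omega> (s i))) \<partial>M)
      \<le> (\<integral>\<omega>. f (\<lambda>i\<in>{..<n}. enn2real (shot_noise h \<Lambda>\<^sub>2 \<omega> (s i))) \<partial>N)"
  proof (rule rm_le_limit[where B = B, OF block_sum_closed_dcx le \<Lambda> f n B])
    show "integrable M W\<^sub>1" "integrable N W\<^sub>2" by fact+
  qed (use int W\<^sub>1(2) W\<^sub>2(2) in \<open>auto dest: borel_measurable_integrable\<close>)
qed

theorem theorem2p1:
  fixes M\<^sub>1 :: "'w measure" and M\<^sub>2 :: "'v measure"
    and \<Lambda>\<^sub>1 :: "'w \<Rightarrow> ('e :: {second_countable_topology, t2_space}) measure"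
    and \<Lambda>\<^sub>2 :: "'v \<Rightarrow> 'e measure"
    and S :: "'s set" and h :: "'e \<Rightarrow> 's \<Rightarrow> ennreal"
  assumes "locally_compact_space (euclidean :: 'e topology)"
    and "\<And>y. y \<in> S \<Longrightarrow> (\<lambda>x. h x y) \<in> borel_measurable borel"
    and "prob_space M\<^sub>1" and "prob_space M\<^sub>2"
    and "random_measure M\<^sub>1 \<Lambda>\<^sub>1" and "random_measure M\<^sub>2 \<Lambda>\<^sub>2"
  shows "(rm_le idcx M\<^sub>1 \<Lambda>\<^sub>1 M\<^sub>2 \<Lambda>\<^sub>2 \<longrightarrow>
            ext_field_le idcx S M\<^sub>1 (shot_noise h \<Lambda>\<^sub>1) M\<^sub>2 (shot_noise h \<Lambda>\<^sub>2)) \<and>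
         (rm_le idcv M\<^sub>1 \<Lambda>\<^sub>1 M\<^sub>2 \<Lambda>\<^sub>2 \<longrightarrow>
            ext_field_le idcv S M\<^sub>1 (shot_noise h \<Lambda>\<^sub>1) M\<^sub>2 (shot_noise h \<Lambda>\<^sub>2)) \<and>
         ((\<forall>y\<in>S. (\<integral>\<^sup>+\<omega>. shot_noise h \<Lambda>\<^sub>1 \<omega> y \<partial>M\<^sub>1) < \<infinity> \<and> (\<integral>\<^sup>+\<omega>. shot_noise h \<Lambda>\<^sub>2 \<omega> y \<partial>M\<^sub>2) < \<infinity>) \<longrightarrow>
          rm_le dcx M\<^sub>1 \<Lambda>\<^sub>1 M\<^sub>2 \<Lambda>\<^sub>2 \<longrightarrow>
            field_le dcx S M\<^sub>1 (\<lambda>\<omega> y. enn2real (shot_noise h \<Lambda>\<^sub>1 \<omega> y))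
                           M\<^sub>2 (\<lambda>\<omega> y. enn2real (shot_noise h \<Lambda>\<^sub>2 \<omega> y)))"
proof (intro conjI impI)
  assume "rm_le idcx M\<^sub>1 \<Lambda>\<^sub>1 M\<^sub>2 \<Lambda>\<^sub>2"
  then show "ext_field_le idcx S M\<^sub>1 (shot_noise h \<Lambda>\<^sub>1) M\<^sub>2 (shot_noise h \<Lambda>\<^sub>2)"
    by (intro ext_field_le_shot_noise[OF assms block_sum_closed_idcx])
      (auto simp: idcx_def intro: dcx_section_continuous)
next
  assume "rm_le idcv M\<^sub>1 \<Lambda>\<^sub>1 M\<^sub>2 \<Lambda>\<^sub>2"
  then show "ext_field_le idcv S M\<^sub>1 (shot_noise h \<Lambda>\<^sub>1) M\<^sub>2 (shot_noise h \<Lambda>\<^sub>2)"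
    by (intro ext_field_le_shot_noise[OF assms block_sum_closed_idcv])
      (auto simp: idcv_def intro: dcv_section_continuous)
next
  assume "\<forall>y\<in>S. (\<integral>\<^sup>+\<omega>. shot_noise h \<Lambda>\<^sub>1 \<omega> y \<partial>M\<^sub>1) < \<infinity> \<and> (\<integral>\<^sup>+\<omega>. shot_noise h \<Lambda>\<^sub>2 \<omega> y \<partial>M\<^sub>2) < \<infinity>"
    and "rm_le dcx M\<^sub>1 \<Lambda>\<^sub>1 M\<^sub>2 \<Lambda>\<^sub>2"
  then show "field_le dcx S M\<^sub>1 (\<lambda>\<omega> y. enn2real (shot_noise h \<Lambda>\<^sub>1 \<omega> y))
      M\<^sub>2 (\<lambda>\<omega> y. enn2real (shot_noise h \<Lambda>\<^sub>2 \<omega> y))"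
    by (intro field_le_dcx_shot_noise assms)
qed

end
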